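(* Let $\alpha,\alpha'>1/2$ be real and let $\boldsymbol{\gamma}=(\gamma_u)_u$, $\boldsymbol{\gamma}'=(\gamma'_u)_u$ be families of non-negative real weights such that $\gamma_v\ge\gamma_u$ whenever $v\subset u$. For $s,N\in\mathbb{N}$ let $\boldsymbol{z}\in\{1,\ldots,N-1\}^s$ be a vector constructed by the component-by-component (CBC) algorithm for lattice rules based on the criterion $P_{\alpha,\boldsymbol{\gamma},N}$. Then the following holds. 1. (General weights.) Assume that there exist $\lambda,\delta,q,q'\ge0$ such that $1/(2\alpha)<\lambda<1$, $0<\delta<\alpha'/(\alpha\lambda)$, $$\sup_{s\in\mathbb{N}}\frac1{s^q}\sum_{\emptyset\ne u\subseteq\{1,\ldots,s\}}\gamma_u^\lambda(2\zeta(2\alpha\lambda))^{|u|}<\infty$$ and $$\sup_{s,N\in\mathbb{N}}\frac1{s^{q'}(\varphi(N))^\delta}\sum_{\emptyset\ne u\subseteq\{1,\ldots,s\}}\frac{\gamma'_u}{\gamma_u^{\alpha'/\alpha}}\left(\frac{2^{2\alpha'+1}}{2^{2\alpha'-1}-1}\right)^{|u|}(\log_2N)^{|u|-1}<\infty.$$ Then $P_{\alpha',\boldsymbol{\gamma}',N}(\boldsymbol{z})$ depends only polynomially on $s$: there is a constant $C_\delta>0$ independent of $s$ and $N$ such that $$P_{\alpha',\boldsymbol{\gamma}',N}(\boldsymbol{z})\le C_\delta\, s^{q\alpha'/(\alpha\lambda)+q'}(\varphi(N))^{-\alpha'/(\alpha\lambda)+\delta}.$$ If there exist $\lambda,\delta$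 with $1/(2\alpha)<\lambda<1$ and $0<\delta<\alpha'/(\alpha\lambda)$ such that $$\sup_{s\in\mathbb{N}}\sum_{\emptyset\ne u\subseteq\{1,\ldots,s\}}\gamma_u^\lambda(2\zeta(2\alpha\lambda))^{|u|}<\infty\quad\text{and}\quad\sup_{s,N\in\mathbb{N}}\frac1{(\varphi(N))^\delta}\sum_{\emptyset\ne u\subseteq\{1,\ldots,s\}}\frac{\gamma'_u}{\gamma_u^{\alpha'/\alpha}}\left(\frac{2^{2\alpha'+1}}{2^{2\alpha'-1}-1}\right)^{|u|}(\log_2N)^{|u|-1}<\infty$$ (the case $q=q'=0$), then $P_{\alpha',\boldsymbol{\gamma}',N}(\boldsymbol{z})$ is bounded independently of $s$. 2. (Product weights.) Suppose $\boldsymbol{\gamma}$ and $\boldsymbol{\gamma}'$ are product weights, $\gamma_u=\prod_{j\in u}\gamma_j$ and $\gamma'_u=\prod_{j\in u}\gamma'_j$ with $\gamma_j,\gamma'_j\ge0$, and that there exists $\lambda\in(1/(2\alpha),1]$ such that $$\sum_{j=1}^\infty\gamma_j^\lambda<\infty\quad\text{and}\quad\sum_{j=1}^\infty\frac{\gamma'_j}{\gamma_j^{\alpha'/\alpha}}<\infty.$$ Then for arbitrarily small $\delta>0$ there is a constant $C_\delta>0$ independent of $s$ and $N$ such that $$P_{\alpha',\boldsymbol{\gamma}',N}(\boldsymbol{z})\le C_\delta(\varphi(N))^{-\alpha'/(\alpha\lambda)+\delta}.$$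
   Context: $\mathbb{N}$ is the set of positive integers, $\zeta$ the Riemann zeta function, $\varphi$ the Euler totient function. Weights are families $\boldsymbol{\gamma}=(\gamma_u)$ of non-negative reals indexed by the finite non-empty subsets $u\subset\mathbb{N}$. Since $\boldsymbol{z}\in\{1,\ldots,N-1\}^s$, the conclusions concern $N\ge2$. For $\boldsymbol{z}\in\{1,\ldots,N-1\}^s$ and non-empty $u\subseteq\{1,\ldots,s\}$ let $$P_u^\perp(\boldsymbol{z})=\Bigl\{\boldsymbol{k}_u=(k_j)_{j\in u}\in(\mathbb{Z}\setminus\{0\})^{|u|} : \sum_{j\in u}k_jz_j\equiv0 \pmod N\Bigr\},$$ let $r_\alpha(\boldsymbol{\gamma},\boldsymbol{k}_u)=\gamma_u\prod_{j\in u}|k_j|^{-2\alpha}$, and define $$P_{\alpha,\boldsymbol{\gamma},N}(\boldsymbol{z})=\sum_{\emptyset\ne u\subseteq\{1,\ldots,s\}}\ \sum_{\boldsymbol{k}_u\in P_u^\perp(\boldsymbol{z})}r_\alpha(\boldsymbol{\gamma},\boldsymbol{k}_u).$$ The same definition is used for vectors of any length $\ell$ (with $s$ replaced by $\ell$). ($P_{\alpha,\boldsymbol{\gamma},N}(\boldsymbol{z})$ is the squared worst-case error of the lattice rule $f\mapsto\frac1N\sum_{n=0}^{N-1}f(\{n\boldsymbol{z}/N\})$ in the weighted Korobov space with smoothness $\alpha$ and weights $\boldsymbol{\gamma}$.) CBC algorithm for lattice rules based on $P_{\alpha,\boldsymbol{\gamma},N}$: set $z^*_1=1$; for $\ell=1,\ldots,s-1$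 successively, with $z^*_1,\ldots,z^*_\ell$ kept fixed, let $z^*_{\ell+1}$ be a minimizer of $P_{\alpha,\boldsymbol{\gamma},N}(z^*_1,\ldots,z^*_\ell,z_{\ell+1})$ over $z_{\ell+1}\in\{1,\ldots,N-1\}$. The output is $\boldsymbol{z}=(z^*_1,\ldots,z^*_s)$. Convention: $0/0=0$, and $c/0=+\infty$ for $c>0$, in the ratios of weights. *)

theory Defs
  imports
    "HOL-Analysis.Analysis"
    "HOL-Number_Theory.Number_Theory"
begin

text \<open>
  Vectors of length \<open>s\<close> are functions on \<open>nat\<close>, of which only the values at \<open>1, \<dots>, s\<close> are used.
  Families of weights are functions on \<open>nat set\<close>, of which only the values at finite non-empty sets
  of positive integers are used.
\<close>

definition index_set :: "nat set \<Rightarrow> bool" where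
  "index_set u \<longleftrightarrow> finite u \<and> u \<noteq> {} \<and> u \<subseteq> {1..}"

definition nonempty_subsets :: "nat \<Rightarrow> nat set set" where
  "nonempty_subsets s = {u. u \<noteq> {} \<and> u \<subseteq> {1..s}}"

text \<open>The restriction of the Riemann zeta function to real arguments \<open>x > 1\<close>.\<close>

definition real_zeta :: "real \<Rightarrow> real" where
  "real_zeta x = (\<Sum>n. 1 / real (Suc n) powr x)"

text \<open>
  Division on \<open>ennreal\<close> satisfies \<open>0 / 0 = 0\<close> and \<open>c / 0 = \<infinity>\<close> for \<open>c > 0\<close>.
\<close>

definition weight_ratio :: "real \<Rightarrow> real \<Rightarrow> real \<Rightarrow> ennreal" where
  "weight_ratio a b t = ennreal a / ennreal (b powr t)"

definition dual_set :: "nat \<Rightarrow> (nat \<Rightarrow> nat) \<Rightarrow> nat set \<Rightarrow> (nat \<Rightarrow> int) set" where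
  "dual_set N z u =
     {k \<in> u \<rightarrow>\<^sub>E (UNIV - {0}). [(\<Sum>j\<in>u. k j * int (z j)) = 0] (mod int N)}"

definition korobov_r :: "real \<Rightarrow> (nat set \<Rightarrow> real) \<Rightarrow> nat set \<Rightarrow> (nat \<Rightarrow> int) \<Rightarrow> real" where
  "korobov_r \<alpha> \<gamma> u k = \<gamma> u * (\<Prod>j\<in>u. \<bar>real_of_int (k j)\<bar> powr (- 2 * \<alpha>))"

definition korobov_P ::
  "real \<Rightarrow> (nat set \<Rightarrow> real) \<Rightarrow> nat \<Rightarrow> nat \<Rightarrow> (nat \<Rightarrow> nat) \<Rightarrow> real" where
  "korobov_P \<alpha> \<gamma> N s z =
     (\<Sum>u\<in>nonempty_subsets s. \<Sum>\<^sub>\<infinity>k\<in>dual_set N z u. korobov_r \<alpha> \<gamma> u k)"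

text \<open>
  \<open>z\<close> is a possible output of the algorithm: minimizers need not be unique.
\<close>

definition cbc_vector ::
  "real \<Rightarrow> (nat set \<Rightarrow> real) \<Rightarrow> nat \<Rightarrow> nat \<Rightarrow> (nat \<Rightarrow> nat) \<Rightarrow> bool" where
  "cbc_vector \<alpha> \<gamma> N s z \<longleftrightarrow>
     z \<in> {1..s} \<rightarrow> {1..N - 1} \<and> z 1 = 1 \<and>
     (\<forall>l\<in>{1..<s}. is_arg_min (\<lambda>t. korobov_P \<alpha> \<gamma> N (Suc l) (z(Suc l := t)))
        (\<lambda>t. t \<in> {1..N - 1}) (z (Suc l)))"

text \<open>
  The following two facts ensure that the infinite sums in \<open>korobov_P\<close> are genuine, rather than
  the default value \<open>0\<close> of a divergent sum.
\<close>

lemma summable_on_int_powr: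
  assumes "\<alpha> > 1/2"
  shows "(\<lambda>k::int. \<bar>real_of_int k\<bar> powr (- 2 * \<alpha>)) summable_on UNIV - {0}"
proof -
  let ?f = "\<lambda>k::int. \<bar>real_of_int k\<bar> powr (- 2 * \<alpha>)"
  have "summable (\<lambda>n. real n powr (- 2 * \<alpha>))"
    using assms by (subst summable_real_powr_iff) auto
  then have n: "(\<lambda>n. real n powr (- 2 * \<alpha>)) summable_on UNIV"
    by (intro norm_summable_imp_summable_on) auto
  have "?f summable_on range int"
    by (subst summable_on_reindex) (use n in \<open>auto simp: o_def\<close>)
  moreover have "?f summable_on range (\<lambda>n. - int n)"
    by (subst summable_on_reindex) (use n in \<open>auto simp: o_def inj_on_def\<close>)
  ultimately have "?f summable_on (range int \<union> range (\<lambda>n. - int n))"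
    by (rule summable_on_union)
  then have "?f summable_on UNIV"
  proof (rule summable_on_subset)
    show "UNIV \<subseteq> range int \<union> range (\<lambda>n. - int n)"
    proof
      fix k :: int
      show "k \<in> range int \<union> range (\<lambda>n. - int n)"
        by (cases k rule: int_cases2) auto
    qed
  qed
  then show ?thesis
    by (rule summable_on_subset) auto
qed

lemma korobov_r_summable_on:
  assumes "\<alpha> > 1/2" "finite u"
  shows "korobov_r \<alpha> \<gamma> u summable_on dual_set N z u"
proof -
  let ?f = "\<lambda>k::int. \<bar>real_of_int k\<bar> powr (- 2 * \<alpha>)"
  have nn: "norm (?f k) = ?f k" for k by simp
  have "Infinite_Set_Sum.abs_summable_on ?f (UNIV - {0})"
    using summable_on_int_powr[OF assms(1)] unfolding abs_summable_equivalent[symmetric] nn .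
  then have "Infinite_Set_Sum.abs_summable_on (\<lambda>k. \<Prod>j\<in>u. ?f (k j)) (u \<rightarrow>\<^sub>E (UNIV - {0}))"
    using assms(2) by (intro abs_summable_on_prod_PiE) auto
  then have "(\<lambda>k. \<Prod>j\<in>u. ?f (k j)) summable_on (u \<rightarrow>\<^sub>E (UNIV - {0}))"
    unfolding abs_summable_equivalent[symmetric] by (rule abs_summable_summable)
  then have "(\<lambda>k. \<Prod>j\<in>u. ?f (k j)) summable_on dual_set N z u"
    by (rule summable_on_subset) (auto simp: dual_set_def)
  then show ?thesis
    unfolding korobov_r_def by (rule summable_on_cmult_right)
qed

end

theory Submission
  imports Defs "HOL-Library.Discrete_Functions"
begin

text \<open>
  Averaging over the units modulo \<open>N\<close> bounds the criterion by
  \<open>P\<^sub>\<alpha>\<^sub>,\<^sub>\<gamma>(z) powr lam \<le> (\<Sum>u. \<gamma> u powr lam * (2 * \<zeta> (2 * \<alpha> * lam)) ^ card u) / \<phi>(N)\<close>. Each single summand of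
  \<open>P\<^sub>\<alpha>\<^sub>,\<^sub>\<gamma>(z)\<close> obeys the same bound, so by the monotonicity of the weights every dual vector \<open>k\<close> supported
  in \<open>u\<close> has \<open>\<Prod>\<bar>k j\<bar> \<ge> \<rho>\<close> (product over its support), where \<open>\<rho>\<close> is a power of \<open>\<gamma> u\<close> over that bound.
  The dual vectors form a lattice, so this also separates them from each other, and counting them in
  dyadic boxes bounds \<open>\<Sum>k. \<Prod>\<bar>k j\<bar> powr (- 2 * \<alpha>')\<close> by
  \<open>\<rho> powr (- 2 * \<alpha>') * K ^ card u * (log 2 N) ^ (card u - 1)\<close>. For product weights the sum of the weight ratios
  factorises into a product that is \<open>O(N powr \<epsilon>)\<close> for every \<open>\<epsilon> > 0\<close>, and \<open>N \<le> 2 \<phi>(N)\<^sup>2\<close>.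
\<close>

section \<open>Sums of powers\<close>

text \<open>All that passes from \<open>\<alpha>\<close>, \<open>\<gamma>\<close> to
  \<open>\<alpha>'\<close>, \<open>\<gamma>'\<close> is the lower bound \<open>\<rho>\<close>, a
  weighted Zaremba index for each \<open>u\<close>. Hence the algorithm need not know the new
  parameters, and the ratio \<open>\<gamma>' u / \<gamma> u powr (\<alpha>' / \<alpha>)\<close> is
  just \<open>\<gamma>' u * \<rho> powr (- 2 * \<alpha>')\<close> up to a factor independent of
  \<open>u\<close>. \<open>N\<close> need not be prime. For a non-unit \<open>t\<close> already
  \<open>y = N / gcd t N\<close> solves \<open>y t = 0\<close> modulo \<open>N\<close>, so the
  minimum over \<open>{1..N - 1}\<close> is compared with the mean over the units only; this is why
  the rate is in \<open>\<phi>(N)\<close>. Taking the mean of the power \<open>lam\<close> improves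
  the rate of the criterion from \<open>1\<close> to \<open>1 / lam\<close>. The delicate point is
  to reach the prescribed constant \<open>4 / (1 - 2 powr (1 - 2 * \<alpha>'))\<close> per
  coordinate with one logarithm fewer than coordinates. It is composed of \<open>2\<close> for the
  sign, \<open>1 / (1 - 2 powr (1 - 2 * \<alpha>'))\<close> for a geometric series, and
  \<open>2\<close> from \<open>t + 2 \<le> 2 * log 2 N\<close>, where \<open>2 ^ t\<close> is the
  dyadic size of \<open>\<rho>\<close>.\<close>

lemma powr_add_le:
  fixes x y l :: real
  assumes "x \<ge> 0" "y \<ge> 0" "0 < l" "l \<le> 1"
  shows "(x + y) powr l \<le> x powr l + y powr l"
proof (cases "x + y = 0")
  case True
  with assms have "x = 0" "y = 0" by linarith+
  then show ?thesis by simp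
next
  case False
  with assms have pos: "x + y > 0" by linarith
  \<comment> \<open>On \<open>[0, 1]\<close> an exponent of at most \<open>1\<close> does not
    decrease a number; this is applied to the two normalised summands.\<close>
  have *: "a / (x + y) \<le> (a / (x + y)) powr l" if "0 \<le> a" "a \<le> x + y" for a
    using powr_mono'[of l 1 "a / (x + y)"] assms that pos by simp
  have "1 = x / (x + y) + y / (x + y)"
    using pos by (simp flip: add_divide_distrib)
  also have "\<dots> \<le> (x / (x + y)) powr l + (y / (x + y)) powr l"
    using *[of x] *[of y] assms by simp
  also have "\<dots> = (x powr l + y powr l) / (x + y) powr l"
    using assms pos by (simp add: powr_divide add_divide_distrib)
  finally show ?thesis
    using pos by (simp add: field_simps)
qed

lemma sum_powr_le:
  fixes f :: "'a \<Rightarrow> real"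
  assumes "\<And>x. x \<in> A \<Longrightarrow> f x \<ge> 0" "0 < l" "l \<le> 1"
  shows "sum f A powr l \<le> (\<Sum>x\<in>A. f x powr l)"
  using assms(1)
proof (induction A rule: infinite_finite_induct)
  case (insert x A)
  then have "sum f (insert x A) powr l \<le> f x powr l + sum f A powr l"
    using powr_add_le[of "f x" "sum f A" l] assms by (simp add: sum_nonneg)
  also have "\<dots> \<le> f x powr l + (\<Sum>x\<in>A. f x powr l)"
    using insert by simp
  finally show ?case using insert by simp
qed auto

lemma summable_real_zeta:
  assumes "p > 1"
  shows "summable (\<lambda>n. 1 / real (Suc n) powr p)"
proof -
  have "summable (\<lambda>n. real n powr (- p))"
    using assms by (subst summable_real_powr_iff) auto
  then have "summable (\<lambda>n. real (Suc n) powr (- p))"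
    by (subst summable_Suc_iff)
  then show ?thesis by (simp only: powr_minus_divide)
qed

lemma sum_powr_le_real_zeta:
  fixes K :: "nat set"
  assumes "p > 1" "finite K" "0 \<notin> K"
  shows "(\<Sum>m\<in>K. real m powr (- p)) \<le> real_zeta p"
proof -
  have K: "K = Suc ` ((\<lambda>m. m - 1) ` K)"
  proof -
    have "Suc (m - 1) = m" if "m \<in> K" for m
      using that assms(3) by (cases m) auto
    then show ?thesis by (simp add: image_image cong: image_cong)
  qed
  have "(\<Sum>m\<in>K. real m powr (- p)) = (\<Sum>n\<in>(\<lambda>m. m - 1) ` K. 1 / real (Suc n) powr p)"
    by (subst K, subst sum.reindex) (auto simp: powr_minus_divide)
  also have "\<dots> \<le> real_zeta p"
    unfolding real_zeta_def using assms summable_real_zeta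
    by (intro sum_le_suminf) auto
  finally show ?thesis .
qed

lemma sum_int_powr_le_real_zeta:
  fixes K :: "int set"
  assumes "p > 1" "finite K" "0 \<notin> K"
  shows "(\<Sum>y\<in>K. \<bar>real_of_int y\<bar> powr (- p)) \<le> 2 * real_zeta p"
proof -
  have half: "(\<Sum>y\<in>H. \<bar>real_of_int y\<bar> powr (- p)) \<le> real_zeta p"
    if H: "finite H" "0 \<notin> H" "inj_on (\<lambda>y. nat \<bar>y\<bar>) H" for H :: "int set"
  proof -
    have "(\<Sum>y\<in>H. \<bar>real_of_int y\<bar> powr (- p)) = (\<Sum>m\<in>(\<lambda>y. nat \<bar>y\<bar>) ` H. real m powr (- p))"
      using H by (subst sum.reindex) auto
    also have "\<dots> \<le> real_zeta p"
      using H assms(1) by (intro sum_powr_le_real_zeta) auto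
    finally show ?thesis .
  qed
  have K: "K = {y\<in>K. y > 0} \<union> {y\<in>K. y < 0}"
    using assms(3) by (auto simp: not_less intro: order.not_eq_order_implies_strict)
  have "(\<Sum>y\<in>K. \<bar>real_of_int y\<bar> powr (- p)) =
      (\<Sum>y\<in>{y\<in>K. y > 0}. \<bar>real_of_int y\<bar> powr (- p)) + (\<Sum>y\<in>{y\<in>K. y < 0}. \<bar>real_of_int y\<bar> powr (- p))"
    by (subst K, rule sum.union_disjoint) (use assms(2) in auto)
  also have "\<dots> \<le> real_zeta p + real_zeta p"
    by (intro add_mono half) (use assms in \<open>auto simp: inj_on_def\<close>)
  finally show ?thesis by simp
qed

lemma real_zeta_pos: "p > 1 \<Longrightarrow> real_zeta p > 0"
  unfolding real_zeta_def by (intro suminf_pos summable_real_zeta) auto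

section \<open>The error bound for vectors constructed component by component\<close>

text \<open>Let \<open>g\<close> be the gcd and \<open>N = g * M\<close>. After division by
  \<open>g\<close> the coefficient is a unit modulo \<open>M\<close>, so all solutions agree modulo
  \<open>M\<close>, and each of the \<open>g\<close> blocks of length \<open>M\<close> contains at
  most one.\<close>

lemma card_cong_solutions_le:
  fixes y c :: int
  assumes "N > 0" "T \<subseteq> {..<N}" "\<And>t. t \<in> T \<Longrightarrow> [y * int t + c = 0] (mod int N)"
  shows "card T \<le> nat (gcd y (int N))"
proof -
  define g where "g = nat (gcd y (int N))"
  have g: "int g = gcd y (int N)" "g > 0"
    using assms(1) by (auto simp: g_def)
  then have "g dvd N"
    by (metis gcd_dvd2 int_dvd_int_iff)
  then obtain M where M: "N = g * M" by blast
  obtain y' where y': "y = int g * y'"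
    using g by (metis dvdE gcd_dvd1)
  have "int g * gcd y' (int M) = int g * 1"
    using g(1) by (simp add: M y' gcd_mult_left)
  then have cop: "coprime y' (int M)"
    using g assms(1) by (auto simp: coprime_iff_gcd_eq_1)
  have "inj_on (\<lambda>t. t div M) T"
  proof (rule inj_onI)
    fix t t' assume t: "t \<in> T" "t' \<in> T" and eq: "t div M = t' div M"
    have "[y * int t + c = y * int t' + c] (mod int N)"
      using assms(3)[OF t(1)] assms(3)[OF t(2)] by (metis cong_sym cong_trans)
    then have "int N dvd y * int t - y * int t'"
      by (simp add: cong_iff_dvd_diff)
    also have "y * int t - y * int t' = int g * (y' * (int t - int t'))"
      by (simp add: y' algebra_simps)
    finally have "int M dvd y' * (int t - int t')"
      using g(2) by (simp add: M)
    then have "int M dvd int t - int t'"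
      using cop by (simp add: coprime_dvd_mult_right_iff coprime_commute)
    then have "t mod M = t' mod M"
      by (metis mod_eq_dvd_iff of_nat_eq_iff zmod_int)
    with eq show "t = t'" by (metis div_mult_mod_eq)
  qed
  moreover have "(\<lambda>t. t div M) ` T \<subseteq> {..<g}"
    using assms(2) by (auto simp: M less_mult_imp_div_less)
  ultimately have "card T \<le> card {..<g}"
    by (metis card_inj_on_le finite_lessThan)
  then show ?thesis by (simp add: g_def)
qed

text \<open>A unit \<open>t\<close> can only solve \<open>y t + c \<equiv> 0\<close> if \<open>gcd y N = gcd c N =: g\<close>. Then there are at most
  \<open>g\<close> solutions, and the factor \<open>g\<close> is absorbed because \<open>y\<close> runs through multiples of \<open>g\<close>.\<close>

lemma sum_card_units_le:
  fixes c :: int and K :: "int set"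
  assumes "N > 1" "p > 1" "finite K" "0 \<notin> K"
  shows "(\<Sum>y\<in>K. \<bar>real_of_int y\<bar> powr (- p) *
           real (card {t \<in> totatives N. [y * int t + c = 0] (mod int N)})) \<le> 2 * real_zeta p"
proof -
  define g where "g = gcd c (int N)"
  have g: "g > 0" using assms(1) by (auto simp: g_def)
  define T where "T = (\<lambda>y. {t \<in> totatives N. [y * int t + c = 0] (mod int N)})"
  define K' where "K' = {y\<in>K. g dvd y}"
  have T: "gcd y (int N) = g" if "t \<in> T y" for t y
  proof -
    have "coprime (int t) (int N)"
      using that by (auto simp: T_def totatives_def)
    then have "gcd y (int N) = gcd (y * int t) (int N)"
      by (simp add: gcd_mult_right_right_cancel gcd.commute coprime_commute)
    also have "\<dots> = gcd (- c) (int N)"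
    proof (rule cong_gcd_eq)
      have "[y * int t + c + - c = 0 + - c] (mod int N)"
        by (rule cong_add) (use that in \<open>auto simp: T_def\<close>)
      then show "[y * int t = - c] (mod int N)" by simp
    qed
    finally show ?thesis by (simp add: g_def)
  qed
  have bound: "\<bar>real_of_int y\<bar> powr (- p) * real (card (T y))
      \<le> (if g dvd y then real_of_int g * \<bar>real_of_int y\<bar> powr (- p) else 0)" for y
  proof (cases "T y = {}")
    case False
    then have gy: "gcd y (int N) = g" using T by blast
    have "card (T y) \<le> nat g"
      unfolding gy[symmetric]
      by (rule card_cong_solutions_le[where c = c])
         (use assms(1) totatives_less in \<open>auto simp: T_def\<close>)
    then have "real (card (T y)) \<le> real_of_int g"
      using g by linarith
    moreover have "g dvd y" using gy by auto
    ultimately show ?thesis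
      by (simp add: mult.commute mult_right_mono)
  qed (use g in auto)
  have "(\<Sum>y\<in>K. \<bar>real_of_int y\<bar> powr (- p) * real (card (T y)))
      \<le> (\<Sum>y\<in>K. if g dvd y then real_of_int g * \<bar>real_of_int y\<bar> powr (- p) else 0)"
    by (intro sum_mono bound)
  also have "\<dots> = (\<Sum>y\<in>K'. real_of_int g * \<bar>real_of_int y\<bar> powr (- p))"
    using assms(3) by (simp add: K'_def sum.inter_filter)
  also have "\<dots> \<le> (\<Sum>y\<in>K'. \<bar>real_of_int (y div g)\<bar> powr (- p))"
  proof (rule sum_mono)
    fix y assume "y \<in> K'"
    then obtain y' where y': "y = g * y'" by (auto simp: K'_def)
    have "real_of_int g * \<bar>real_of_int y\<bar> powr (- p) =
        real_of_int g powr (1 - p) * \<bar>real_of_int y'\<bar> powr (- p)"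
      using g by (simp add: y' abs_mult powr_mult powr_diff powr_minus field_simps)
    also have "\<dots> \<le> 1 * \<bar>real_of_int y'\<bar> powr (- p)"
      using g assms(2) powr_mono[of "1 - p" 0 "real_of_int g"] by (intro mult_right_mono) auto
    finally show "real_of_int g * \<bar>real_of_int y\<bar> powr (- p) \<le> \<bar>real_of_int (y div g)\<bar> powr (- p)"
      using g by (simp add: y')
  qed
  also have "\<dots> = (\<Sum>y\<in>(\<lambda>y. y div g) ` K'. \<bar>real_of_int y\<bar> powr (- p))"
    by (subst sum.reindex) (auto simp: K'_def inj_on_def dvd_div_eq_iff)
  also have "\<dots> \<le> 2 * real_zeta p"
    using assms g by (intro sum_int_powr_le_real_zeta) (auto simp: K'_def)
  finally show ?thesis by (simp add: T_def)
qed

text \<open>The weight is left out and the exponent is free because \<open>2 * \<alpha>\<close>,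
  \<open>2 * \<alpha> * lam\<close> and \<open>2 * \<alpha>'\<close> all occur.\<close>

definition dual_sum :: "real \<Rightarrow> nat \<Rightarrow> (nat \<Rightarrow> nat) \<Rightarrow> nat set \<Rightarrow> real" where
  "dual_sum p N z u = (\<Sum>\<^sub>\<infinity>k\<in>dual_set N z u. \<Prod>j\<in>u. \<bar>real_of_int (k j)\<bar> powr (- p))"

lemma summable_on_dual_set:
  assumes "p > 1" "finite u"
  shows "(\<lambda>k. \<Prod>j\<in>u. \<bar>real_of_int (k j)\<bar> powr (- p)) summable_on dual_set N z u"
  using korobov_r_summable_on[of "p / 2" u "\<lambda>_. 1" N z] assms by (simp add: korobov_r_def[abs_def])

lemma dual_sum_nonneg: "dual_sum p N z u \<ge> 0"
  unfolding dual_sum_def by (intro infsum_nonneg prod_nonneg) auto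

lemma korobov_P_eq_dual_sum:
  "korobov_P \<alpha> \<gamma> N s z = (\<Sum>u\<in>nonempty_subsets s. \<gamma> u * dual_sum (2 * \<alpha>) N z u)"
  unfolding korobov_P_def korobov_r_def dual_sum_def by (simp add: infsum_cmult_right')

lemma finite_nonempty_subsets [simp]: "finite (nonempty_subsets s)"
  by (rule finite_subset[of _ "Pow {1..s}"]) (auto simp: nonempty_subsets_def)

lemma nonempty_subsets_index_set: "u \<in> nonempty_subsets s \<Longrightarrow> index_set u"
  by (auto simp: nonempty_subsets_def index_set_def intro: finite_subset)

lemma dual_set_cong:
  assumes "\<And>j. j \<in> u \<Longrightarrow> z j = z' j"
  shows "dual_set N z u = dual_set N z' u"
  using assms by (simp add: dual_set_def cong: sum.cong)

lemma dual_sum_cong: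
  assumes "\<And>j. j \<in> u \<Longrightarrow> z j = z' j"
  shows "dual_sum p N z u = dual_sum p N z' u"
  unfolding dual_sum_def by (simp add: dual_set_cong[OF assms])

text \<open>Jensen's inequality for an infinite sum. Finite subsums bound only the sum itself, not a
  power of it, so the exponent is first moved to the right as \<open>1 / l\<close>.\<close>

lemma dual_sum_powr_le:
  assumes "finite u" "0 < l" "l \<le> 1" "p * l > 1"
  shows "dual_sum p N z u powr l \<le> dual_sum (p * l) N z u"
proof -
  let ?f = "\<lambda>p k. \<Prod>j\<in>u. \<bar>real_of_int (k j)\<bar> powr (- p)"
  have p: "p > 1"
    using assms by (smt (verit) mult_less_cancel_left_pos mult.right_neutral mult_le_0_iff mult_left_le)
  have fl: "?f p k powr l = ?f (p * l) k" for k
    by (simp add: prod_powr_distrib powr_powr)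
  have "dual_sum p N z u \<le> dual_sum (p * l) N z u powr (1 / l)"
    unfolding dual_sum_def[of p]
  proof (rule infsum_le_finite_sums)
    fix F assume F: "finite F" "F \<subseteq> dual_set N z u"
    have "sum (?f p) F = (sum (?f p) F powr l) powr (1 / l)"
      using assms by (simp add: powr_powr sum_nonneg prod_nonneg)
    also have "\<dots> \<le> (\<Sum>k\<in>F. ?f p k powr l) powr (1 / l)"
      using assms by (intro powr_mono2 sum_powr_le) (auto intro: prod_nonneg)
    also have "(\<Sum>k\<in>F. ?f p k powr l) powr (1 / l) \<le> dual_sum (p * l) N z u powr (1 / l)"
    proof (rule powr_mono2)
      show "(\<Sum>k\<in>F. ?f p k powr l) \<le> dual_sum (p * l) N z u"
        unfolding dual_sum_def fl
        by (rule finite_sum_le_infsum)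
           (use F assms summable_on_dual_set in \<open>auto intro: prod_nonneg\<close>)
    qed (use assms in \<open>auto intro: sum_nonneg\<close>)
    finally show "sum (?f p) F \<le> dual_sum (p * l) N z u powr (1 / l)" .
  qed (use summable_on_dual_set p assms in auto)
  then have "dual_sum p N z u powr l \<le> (dual_sum (p * l) N z u powr (1 / l)) powr l"
    using assms by (intro powr_mono2 dual_sum_nonneg) auto
  then show ?thesis
    using assms by (simp add: powr_powr dual_sum_nonneg)
qed

lemma sum_PiE_insert:
  assumes "i \<notin> u"
  shows "(\<Sum>k\<in>insert i u \<rightarrow>\<^sub>E K. f k) = (\<Sum>k\<in>u \<rightarrow>\<^sub>E K. \<Sum>y\<in>K. f (k(i := y)))"
proof -
  have "(\<Sum>k\<in>insert i u \<rightarrow>\<^sub>E K. f k) = (\<Sum>(y, k)\<in>K \<times> (u \<rightarrow>\<^sub>E K). f (k(i := y)))"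
    unfolding PiE_insert_eq using assms
    by (subst sum.reindex[OF inj_combinator]) (simp_all add: case_prod_unfold)
  also have "\<dots> = (\<Sum>k\<in>u \<rightarrow>\<^sub>E K. \<Sum>y\<in>K. f (k(i := y)))"
    by (subst sum.cartesian_product[symmetric], rule sum.swap)
  finally show ?thesis .
qed

text \<open>Only the entry \<open>k i\<close> meets the averaged component \<open>t\<close>. With
  the other entries fixed, their contribution to the congruence is a constant, and
  \<open>sum_card_units_le\<close> is uniform in it. What remains factorises over the box.\<close>

lemma sum_box_card_units_le:
  fixes K :: "int set" and i :: nat
  assumes N: "N > 1" and p: "p > 1" and u: "finite u" "i \<in> u" and K: "finite K" "0 \<notin> K"
  shows "(\<Sum>k\<in>u \<rightarrow>\<^sub>E K. (\<Prod>j\<in>u. \<bar>real_of_int (k j)\<bar> powr (- p)) *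
            real (card {t \<in> totatives N. [(\<Sum>j\<in>u. k j * int ((z(i := t)) j)) = 0] (mod int N)}))
         \<le> (2 * real_zeta p) ^ card u"
proof -
  define v where "v = u - {i}"
  have v: "u = insert i v" "i \<notin> v" "finite v" using u by (auto simp: v_def)
  have split: "(\<Sum>k\<in>u \<rightarrow>\<^sub>E K. f k) = (\<Sum>k\<in>v \<rightarrow>\<^sub>E K. \<Sum>y\<in>K. f (k(i := y)))"
    for f :: "(nat \<Rightarrow> int) \<Rightarrow> real"
    using sum_PiE_insert[OF v(2), of f K] v(1) by simp
  have pr: "(\<Prod>j\<in>u. \<bar>real_of_int ((k(i := y)) j)\<bar> powr (- p)) =
      (\<Prod>j\<in>v. \<bar>real_of_int (k j)\<bar> powr (- p)) * \<bar>real_of_int y\<bar> powr (- p)" for k :: "nat \<Rightarrow> int" and y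
  proof -
    have "(\<Prod>j\<in>v. \<bar>real_of_int ((k(i := y)) j)\<bar> powr (- p)) = (\<Prod>j\<in>v. \<bar>real_of_int (k j)\<bar> powr (- p))"
      using v by (intro prod.cong) auto
    then show ?thesis using v by simp
  qed
  have sm: "(\<Sum>j\<in>u. (k(i := y)) j * int ((z(i := t)) j)) = y * int t + (\<Sum>j\<in>v. k j * int (z j))"
    for k :: "nat \<Rightarrow> int" and y t
  proof -
    have "(\<Sum>j\<in>v. (k(i := y)) j * int ((z(i := t)) j)) = (\<Sum>j\<in>v. k j * int (z j))"
      using v by (intro sum.cong) auto
    then show ?thesis using v by simp
  qed
  have "(\<Sum>k\<in>u \<rightarrow>\<^sub>E K. (\<Prod>j\<in>u. \<bar>real_of_int (k j)\<bar> powr (- p)) *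
            real (card {t \<in> totatives N. [(\<Sum>j\<in>u. k j * int ((z(i := t)) j)) = 0] (mod int N)})) =
     (\<Sum>k\<in>v \<rightarrow>\<^sub>E K. (\<Prod>j\<in>v. \<bar>real_of_int (k j)\<bar> powr (- p)) * (\<Sum>y\<in>K. \<bar>real_of_int y\<bar> powr (- p) *
        real (card {t \<in> totatives N. [y * int t + (\<Sum>j\<in>v. k j * int (z j)) = 0] (mod int N)})))"
    by (subst split) (simp only: pr sm sum_distrib_left mult.assoc)
  also have "\<dots> \<le> (\<Sum>k\<in>v \<rightarrow>\<^sub>E K. (\<Prod>j\<in>v. \<bar>real_of_int (k j)\<bar> powr (- p)) * (2 * real_zeta p))"
    using assms by (intro sum_mono mult_left_mono sum_card_units_le prod_nonneg) auto
  also have "\<dots> = (\<Prod>j\<in>v. \<Sum>y\<in>K. \<bar>real_of_int y\<bar> powr (- p)) * (2 * real_zeta p)"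
    using v K by (subst prod_sum_PiE) (auto simp: sum_distrib_right)
  also have "\<dots> \<le> (2 * real_zeta p) ^ card v * (2 * real_zeta p)"
    unfolding prod_constant using real_zeta_pos[OF p] sum_int_powr_le_real_zeta[OF p K]
    by (intro mult_right_mono power_mono sum_nonneg) auto
  also have "\<dots> = (2 * real_zeta p) ^ card u"
    using v by simp
  finally show ?thesis .
qed

lemma has_sum_sum_finite:
  fixes f :: "'t \<Rightarrow> 'a \<Rightarrow> 'b :: topological_comm_monoid_add"
  assumes "\<And>t. t \<in> T \<Longrightarrow> (f t has_sum s t) A"
  shows "((\<lambda>k. \<Sum>t\<in>T. f t k) has_sum (\<Sum>t\<in>T. s t)) A"
  using assms by (induction T rule: infinite_finite_induct) (auto intro: has_sum_add)

lemma sum_dual_sum_units_le: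
  assumes N: "N > 1" and p: "p > 1" and u: "finite u" "i \<in> u"
  shows "(\<Sum>t\<in>totatives N. dual_sum p N (z(i := t)) u) \<le> (2 * real_zeta p) ^ card u"
proof -
  let ?f = "\<lambda>k. \<Prod>j\<in>u. \<bar>real_of_int (k j)\<bar> powr (- p)"
  let ?D = "\<lambda>t. dual_set N (z(i := t)) u"
  \<comment> \<open>The domain of summation depends on \<open>t\<close>. Extension by zero to the
    common set \<open>?U\<close> allows the sum over \<open>t\<close> to be taken inside.\<close>
  let ?g = "\<lambda>t k. if k \<in> ?D t then ?f k else 0"
  let ?U = "u \<rightarrow>\<^sub>E (UNIV - {0 :: int})"
  have D: "?D t \<subseteq> ?U" for t by (auto simp: dual_set_def)
  have g: "?g t summable_on ?U" for t
    using summable_on_dual_set[OF p u(1), of N "z(i := t)"] D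
    by (subst summable_on_cong_neutral[where T = "?D t" and g = ?f]) auto
  have "(?g t has_sum dual_sum p N (z(i := t)) u) ?U" for t
  proof -
    have "dual_sum p N (z(i := t)) u = infsum (?g t) ?U"
      unfolding dual_sum_def using D by (intro infsum_cong_neutral) auto
    then show ?thesis using has_sum_infsum[OF g] by simp
  qed
  then have "((\<lambda>k. \<Sum>t\<in>totatives N. ?g t k) has_sum
      (\<Sum>t\<in>totatives N. dual_sum p N (z(i := t)) u)) ?U"
    by (rule has_sum_sum_finite)
  then show ?thesis
  proof (rule has_sum_le_finite_sums)
    fix F assume F: "finite F" "F \<subseteq> ?U"
    \<comment> \<open>A finite set of vectors lies in the box of all vectors whose entries occur in
      it, and over a box the sum factorises.\<close>
    define K where "K = (\<Union>k\<in>F. k ` u)"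
    have K: "finite K" "0 \<notin> K" using F u by (auto simp: K_def PiE_iff)
    have FK: "F \<subseteq> u \<rightarrow>\<^sub>E K" using F by (auto simp: K_def PiE_iff)
    have "(\<Sum>k\<in>F. \<Sum>t\<in>totatives N. ?g t k) \<le> (\<Sum>k\<in>u \<rightarrow>\<^sub>E K. \<Sum>t\<in>totatives N. ?g t k)"
      using FK u K by (intro sum_mono2 finite_PiE sum_nonneg) (auto intro: prod_nonneg)
    also have "\<dots> = (\<Sum>k\<in>u \<rightarrow>\<^sub>E K. ?f k *
            real (card {t \<in> totatives N. [(\<Sum>j\<in>u. k j * int ((z(i := t)) j)) = 0] (mod int N)}))"
    proof (rule sum.cong[OF refl])
      fix k assume "k \<in> u \<rightarrow>\<^sub>E K"
      then have "k \<in> ?U" using K by (auto simp: PiE_iff)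
      then have "k \<in> ?D t \<longleftrightarrow> [(\<Sum>j\<in>u. k j * int ((z(i := t)) j)) = 0] (mod int N)" for t
        by (simp add: dual_set_def)
      then show "(\<Sum>t\<in>totatives N. ?g t k) = ?f k *
            real (card {t \<in> totatives N. [(\<Sum>j\<in>u. k j * int ((z(i := t)) j)) = 0] (mod int N)})"
        by (simp add: sum.inter_filter[symmetric] del: fun_upd_apply)
    qed
    also have "\<dots> \<le> (2 * real_zeta p) ^ card u"
      by (rule sum_box_card_units_le[OF N p u K])
    finally show "(\<Sum>k\<in>F. \<Sum>t\<in>totatives N. ?g t k) \<le> (2 * real_zeta p) ^ card u" .
  qed
qed

section \<open>One step of the algorithm\<close>

lemma nonempty_subsets_Suc:
  "nonempty_subsets (Suc l) = nonempty_subsets l \<union> {u \<in> nonempty_subsets (Suc l). Suc l \<in> u}"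
proof -
  have "{1..Suc l} = insert (Suc l) {1..l}" by auto
  then show ?thesis by (auto simp: nonempty_subsets_def)
qed

lemma sum_nonempty_subsets_Suc:
  "sum f (nonempty_subsets (Suc l)) =
     sum f (nonempty_subsets l) + sum f {u \<in> nonempty_subsets (Suc l). Suc l \<in> u}"
  by (subst nonempty_subsets_Suc, rule sum.union_disjoint)
     (auto simp: nonempty_subsets_def intro: finite_subset[of _ "nonempty_subsets (Suc l)"])

text \<open>Index sets without \<open>Suc l\<close> contribute the same for every candidate, so
  minimality passes from the criterion to its increment. For \<open>l = 0\<close> nothing was
  minimised, but a unit \<open>t\<close> has the same dual set as the prescribed component
  \<open>1\<close>.\<close>

lemma cbc_increment_le:
  assumes cbc: "cbc_vector \<alpha> \<gamma> N s z" and N: "N > 1" and l: "l < s" and t: "t \<in> totatives N"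
  defines "U \<equiv> {u \<in> nonempty_subsets (Suc l). Suc l \<in> u}"
  shows "(\<Sum>u\<in>U. \<gamma> u * dual_sum (2 * \<alpha>) N z u)
       \<le> (\<Sum>u\<in>U. \<gamma> u * dual_sum (2 * \<alpha>) N (z(Suc l := t)) u)"
proof (cases "l = 0")
  case True
  have U: "U = {{1}}"
    by (auto simp: U_def True nonempty_subsets_def)
  have "[k * int t = 0] (mod int N) \<longleftrightarrow> [k = 0] (mod int N)" for k
  proof -
    have "coprime (int N) (int t)"
      using t by (auto simp: totatives_def coprime_commute)
    then show ?thesis
      by (simp add: cong_0_iff coprime_dvd_mult_left_iff)
  qed
  then have "dual_set N z {1} = dual_set N (z(1 := t)) {1}"
    using cbc by (simp add: dual_set_def cbc_vector_def)
  then show ?thesis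
    by (simp add: U True dual_sum_def)
next
  case False
  have eq: "korobov_P \<alpha> \<gamma> N (Suc l) (z(Suc l := t')) =
      (\<Sum>u\<in>nonempty_subsets l. \<gamma> u * dual_sum (2 * \<alpha>) N z u) +
      (\<Sum>u\<in>U. \<gamma> u * dual_sum (2 * \<alpha>) N (z(Suc l := t')) u)" for t'
  proof -
    have "dual_sum (2 * \<alpha>) N (z(Suc l := t')) u = dual_sum (2 * \<alpha>) N z u"
      if "u \<in> nonempty_subsets l" for u
      by (rule dual_sum_cong) (use that in \<open>auto simp: nonempty_subsets_def\<close>)
    then show ?thesis
      by (simp add: korobov_P_eq_dual_sum sum_nonempty_subsets_Suc U_def)
  qed
  have "t \<in> {1..N - 1}"
    using t totatives_less[OF t N] by (auto simp: totatives_def)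
  then have "korobov_P \<alpha> \<gamma> N (Suc l) (z(Suc l := z (Suc l))) \<le> korobov_P \<alpha> \<gamma> N (Suc l) (z(Suc l := t))"
    using cbc l False by (force simp: cbc_vector_def is_arg_min_def not_less simp del: fun_upd_apply)
  then show ?thesis
    unfolding eq by simp
qed

text \<open>The weighted sum \<open>\<theta>(t)\<close> over the index sets containing the new component is at most its average
  over the units \<open>t\<close> modulo \<open>N\<close>, and this is applied to \<open>\<theta>(t) powr lam\<close>.\<close>

theorem cbc_error_bound:
  assumes cbc: "cbc_vector \<alpha> \<gamma> N s z" and N: "N > 1"
    and \<gamma>: "\<And>u. index_set u \<Longrightarrow> \<gamma> u \<ge> 0"
    and lam: "1 / (2 * \<alpha>) < lam" "lam \<le> 1" and \<alpha>: "\<alpha> > 1/2"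
  shows "korobov_P \<alpha> \<gamma> N s z powr lam \<le>
    (\<Sum>u\<in>nonempty_subsets s. \<gamma> u powr lam * (2 * real_zeta (2 * \<alpha> * lam)) ^ card u) / real (totient N)"
proof -
  let ?T = "\<lambda>u. \<gamma> u powr lam * (2 * real_zeta (2 * \<alpha> * lam)) ^ card u"
  have lam0: "lam > 0" using lam \<alpha> by (smt (verit) divide_pos_pos)
  have p: "2 * \<alpha> * lam > 1" using lam \<alpha> by (simp add: field_simps)
  have phi: "real (totient N) > 0" using N by simp
  have "korobov_P \<alpha> \<gamma> N l z powr lam \<le> sum ?T (nonempty_subsets l) / real (totient N)" if "l \<le> s" for l
    using that
  proof (induction l)
    case 0
    have "nonempty_subsets 0 = {}" by (auto simp: nonempty_subsets_def)
    then show ?case by (simp add: korobov_P_def)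
  next
    case (Suc l)
    define U where "U = {u \<in> nonempty_subsets (Suc l). Suc l \<in> u}"
    define \<theta> where "\<theta> = (\<lambda>z. \<Sum>u\<in>U. \<gamma> u * dual_sum (2 * \<alpha>) N z u)"
    have U: "finite U" "\<And>u. u \<in> U \<Longrightarrow> index_set u \<and> finite u \<and> Suc l \<in> u \<and> \<gamma> u \<ge> 0"
      using nonempty_subsets_index_set \<gamma> by (auto simp: U_def index_set_def)
    have \<theta>0: "\<theta> z \<ge> 0" for z
      unfolding \<theta>_def by (intro sum_nonneg mult_nonneg_nonneg dual_sum_nonneg) (use U in auto)
    have P0: "korobov_P \<alpha> \<gamma> N l z \<ge> 0"
      unfolding korobov_P_eq_dual_sum
      by (intro sum_nonneg mult_nonneg_nonneg dual_sum_nonneg \<gamma> nonempty_subsets_index_set)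
    have \<theta>_powr: "\<theta> z powr lam \<le> (\<Sum>u\<in>U. \<gamma> u powr lam * dual_sum (2 * \<alpha> * lam) N z u)" for z
    proof -
      have "\<theta> z powr lam \<le> (\<Sum>u\<in>U. (\<gamma> u * dual_sum (2 * \<alpha>) N z u) powr lam)"
        unfolding \<theta>_def using U lam lam0 by (intro sum_powr_le mult_nonneg_nonneg dual_sum_nonneg) auto
      also have "\<dots> \<le> (\<Sum>u\<in>U. \<gamma> u powr lam * dual_sum (2 * \<alpha> * lam) N z u)"
        using U lam lam0 p
        by (intro sum_mono) (auto simp: powr_mult dual_sum_nonneg intro!: mult_left_mono dual_sum_powr_le)
      finally show ?thesis .
    qed
    have "real (totient N) * \<theta> z powr lam = (\<Sum>t\<in>totatives N. \<theta> z powr lam)"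
      by (simp add: totient_def)
    also have "\<dots> \<le> (\<Sum>t\<in>totatives N. \<theta> (z(Suc l := t)) powr lam)"
      using cbc_increment_le[OF cbc N, of l] Suc.prems lam0 \<theta>0
      by (intro sum_mono powr_mono2) (auto simp: \<theta>_def U_def)
    also have "\<dots> \<le> (\<Sum>t\<in>totatives N. \<Sum>u\<in>U. \<gamma> u powr lam * dual_sum (2 * \<alpha> * lam) N (z(Suc l := t)) u)"
      by (intro sum_mono \<theta>_powr)
    also have "\<dots> = (\<Sum>u\<in>U. \<gamma> u powr lam * (\<Sum>t\<in>totatives N. dual_sum (2 * \<alpha> * lam) N (z(Suc l := t)) u))"
      by (subst sum.swap) (simp add: sum_distrib_left)
    also have "\<dots> \<le> sum ?T U"
      using U by (intro sum_mono mult_left_mono sum_dual_sum_units_le N p) auto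
    finally have step: "\<theta> z powr lam \<le> sum ?T U / real (totient N)"
      using phi by (simp add: field_simps)
    have "korobov_P \<alpha> \<gamma> N (Suc l) z = korobov_P \<alpha> \<gamma> N l z + \<theta> z"
      by (simp add: korobov_P_eq_dual_sum sum_nonempty_subsets_Suc \<theta>_def U_def)
    then have "korobov_P \<alpha> \<gamma> N (Suc l) z powr lam \<le> korobov_P \<alpha> \<gamma> N l z powr lam + \<theta> z powr lam"
      using powr_add_le P0 \<theta>0 lam lam0 by simp
    also have "\<dots> \<le> sum ?T (nonempty_subsets l) / real (totient N) + sum ?T U / real (totient N)"
      using Suc step by simp
    also have "\<dots> = sum ?T (nonempty_subsets (Suc l)) / real (totient N)"
      by (simp add: sum_nonempty_subsets_Suc U_def add_divide_distrib)
    finally show ?case .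
  qed
  then show ?thesis by simp
qed

section \<open>Sums over separated points\<close>

lemma sum_geometric_le:
  fixes x :: real
  assumes "0 \<le> x" "x < 1" "finite S"
  shows "(\<Sum>n\<in>S. x ^ n) \<le> 1 / (1 - x)"
proof -
  have "(\<Sum>n\<in>S. x ^ n) \<le> (\<Sum>n. x ^ n)"
    using assms by (intro sum_le_suminf summable_geometric) auto
  then show ?thesis using assms by (simp add: suminf_geometric)
qed

text \<open>The block from \<open>2 ^ M\<close> to \<open>2 ^ (M + 1)\<close> has
  \<open>2 ^ M\<close> terms of size at most \<open>(2 ^ M) powr (- q)\<close>. This geometric
  bound, and not the zeta value, is what the constant of the theorem contains.\<close>

lemma sum_powr_le_geometric:
  fixes K :: "nat set"
  assumes q: "q > 1" and K: "finite K" "0 \<notin> K"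
  shows "(\<Sum>m\<in>K. real m powr (- q)) \<le> 1 / (1 - 2 powr (1 - q))"
proof -
  define x where "x = (2::real) powr (1 - q)"
  have x: "0 \<le> x" "x < 1"
    using q powr_less_mono[of "1 - q" 0 "2 :: real"] by (auto simp: x_def)
  have dyadic: "(\<Sum>m\<in>{1..<2 ^ M}. real m powr (- q)) \<le> (\<Sum>a<M. x ^ a)" for M
  proof (induction M)
    case (Suc M)
    have "(\<Sum>m\<in>{2 ^ M..<2 ^ Suc M}. real m powr (- q)) \<le> (\<Sum>m\<in>{2 ^ M..<2 ^ Suc M :: nat}. (2 ^ M) powr (- q))"
      using q by (intro sum_mono powr_mono2') (auto simp: numeral_power_le_of_nat_cancel_iff)
    also have "\<dots> = 2 powr real M * (2 powr real M) powr (- q)"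
      by (simp add: powr_realpow)
    also have "\<dots> = x ^ M"
      by (simp add: x_def powr_powr powr_power algebra_simps flip: powr_add)
    finally have "(\<Sum>m\<in>{2 ^ M..<2 ^ Suc M}. real m powr (- q)) \<le> x ^ M" .
    moreover have "{1..<2 ^ Suc M} = {1..<2 ^ M} \<union> {2 ^ M..<2 ^ Suc M :: nat}"
      by (auto simp: not_less)
    ultimately show ?case
      using Suc by (simp add: sum.union_disjoint ivl_disj_int)
  qed simp
  obtain n where n: "\<forall>m\<in>K. m < n"
    using K(1) finite_nat_set_iff_bounded by blast
  have "m \<in> {1..<2 ^ n}" if "m \<in> K" for m
    using that n K(2) less_exp[of n] by (cases m) (auto intro: order.strict_trans)
  then have "K \<subseteq> {1..<2 ^ n}" by blast
  then have "(\<Sum>m\<in>K. real m powr (- q)) \<le> (\<Sum>m\<in>{1..<2 ^ n}. real m powr (- q))"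
    by (intro sum_mono2) auto
  also have "\<dots> \<le> (\<Sum>a<n. x ^ a)" by (rule dyadic)
  also have "\<dots> \<le> 1 / (1 - x)" using x by (intro sum_geometric_le) auto
  finally show ?thesis by (simp add: x_def)
qed

text \<open>Only differing coordinates enter the product: the nonzero entries of a difference of
  dual vectors form a dual vector for a possibly smaller index set, and the lower bound is available
  there too.\<close>

definition separated :: "nat set \<Rightarrow> real \<Rightarrow> (nat \<Rightarrow> int) set \<Rightarrow> bool" where
  "separated u \<rho> F \<longleftrightarrow>
     (\<forall>k\<in>F. \<forall>k'\<in>F. k \<noteq> k' \<longrightarrow> \<rho> \<le> (\<Prod>j\<in>{j\<in>u. k j \<noteq> k' j}. \<bar>real_of_int (k j - k' j)\<bar>))"

text \<open>Coordinates other than \<open>i\<close> contribute at most \<open>2 ^ n\<close> to the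
  separating product, so the rest must come from \<open>i\<close>. In both applications
  \<open>2 ^ n \<le> \<rho>\<close>, which makes the first alternative impossible.\<close>

lemma separated_gap:
  assumes sep: "separated u \<rho> F" and kk: "k \<in> F" "k' \<in> F" "k \<noteq> k'"
    and u: "finite u" "i \<in> u"
    and b: "\<And>j. j \<in> u - {i} \<Longrightarrow> \<bar>k j - k' j\<bar> < 2 ^ b j" "(\<Sum>j\<in>u - {i}. b j) = n"
    and ext: "k \<in> extensional u" "k' \<in> extensional u"
  shows "if k i = k' i then \<rho> < 2 ^ n else \<rho> \<le> \<bar>real_of_int (k i - k' i)\<bar> * 2 ^ n"
proof -
  define d where "d = (\<lambda>j. \<bar>real_of_int (k j - k' j)\<bar>)"
  define D where "D = {j\<in>u - {i}. k j \<noteq> k' j}"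
  have D: "finite D" "D \<subseteq> u - {i}" using u by (auto simp: D_def)
  have db: "d j < 2 ^ b j" if "j \<in> D" for j
  proof -
    have "real_of_int \<bar>k j - k' j\<bar> < real_of_int (2 ^ b j)"
      using b(1)[of j] that by (simp only: of_int_less_iff) (auto simp: D_def)
    then show ?thesis by (simp add: d_def)
  qed
  have d0: "0 \<le> d j" for j by (simp add: d_def)
  have n: "(\<Prod>j\<in>D. (2::real) ^ b j) \<le> 2 ^ n"
  proof -
    have "(\<Prod>j\<in>D. (2::real) ^ b j) = 2 ^ (\<Sum>j\<in>D. b j)" by (simp add: power_sum)
    also have "\<dots> \<le> 2 ^ n"
      using D u by (intro power_increasing) (auto simp: b(2)[symmetric] intro: sum_mono2)
    finally show ?thesis .
  qed
  have \<rho>: "\<rho> \<le> prod d {j\<in>u. k j \<noteq> k' j}"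
    using sep kk by (auto simp: separated_def d_def)
  show ?thesis
  proof (cases "k i = k' i")
    case True
    then have eq: "{j\<in>u. k j \<noteq> k' j} = D" by (auto simp: D_def)
    \<comment> \<open>Strictness needs at least one factor; distinct extensional functions that
      agree at \<open>i\<close> provide it.\<close>
    have "D \<noteq> {}"
    proof
      assume "D = {}"
      then have "\<forall>j\<in>u. k j = k' j" using eq by auto
      with ext kk show False by (auto intro: extensionalityI)
    qed
    then obtain j where "j \<in> D" by blast
    then have "prod d D < (\<Prod>j\<in>D. (2::real) ^ b j)"
      using D db d0 by (intro prod_mono_strict[of j]) (auto intro: less_imp_le)
    with \<rho> n True eq show ?thesis by simp
  next
    case False
    then have "{j\<in>u. k j \<noteq> k' j} = insert i D" using u by (auto simp: D_def)
    moreover have "i \<notin> D" by (simp add: D_def)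
    ultimately have "\<rho> \<le> d i * prod d D" using \<rho> D(1) by simp
    also have "\<dots> \<le> d i * (\<Prod>j\<in>D. (2::real) ^ b j)"
      using db d0 by (intro mult_left_mono prod_mono) (auto intro: less_imp_le)
    also have "\<dots> \<le> d i * 2 ^ n" using n d0 by (intro mult_left_mono) auto
    finally show ?thesis using False by (simp add: d_def)
  qed
qed

section \<open>Points of one dyadic class\<close>

lemma abs_diff_same_sign:
  fixes x y :: int
  assumes "(x > 0) = (y > 0)" "x \<noteq> 0" "y \<noteq> 0"
  shows "\<bar>x - y\<bar> = \<bar>\<bar>x\<bar> - \<bar>y\<bar>\<bar>"
  using assms by linarith

lemma abs_diff_less_of_div_eq:
  fixes x y c :: int
  assumes "c > 0" "\<bar>x\<bar> div c = \<bar>y\<bar> div c" "(x > 0) = (y > 0)" "x \<noteq> 0" "y \<noteq> 0"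
  shows "\<bar>x - y\<bar> < c"
proof -
  have "\<bar>x\<bar> - \<bar>y\<bar> = \<bar>x\<bar> mod c - \<bar>y\<bar> mod c"
    using assms(2) by (metis add_diff_cancel_left div_mult_mod_eq)
  moreover have "0 \<le> \<bar>x\<bar> mod c" "\<bar>x\<bar> mod c < c" "0 \<le> \<bar>y\<bar> mod c" "\<bar>y\<bar> mod c < c"
    using assms(1) by auto
  ultimately show ?thesis using abs_diff_same_sign[OF assms(3-5)] by linarith
qed

lemma le_div_iff_int:
  fixes x y c :: int
  assumes "c > 0"
  shows "x \<le> y div c \<longleftrightarrow> x * c \<le> y"
proof
  assume "x \<le> y div c"
  then have "x * c \<le> y div c * c" using assms by simp
  also have "\<dots> \<le> y" using assms by (simp flip: minus_mod_eq_div_mult)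
  finally show "x * c \<le> y" .
qed (use zdiv_mono1[of "x * c" y c] assms in simp)

text \<open>Supplies boxes with sides \<open>2 ^ b j\<close> that fit into a dyadic box with sides
  \<open>2 ^ A j\<close> and have volume exactly \<open>2 ^ t\<close>.\<close>

lemma exists_smaller_exponents:
  assumes "finite v" "t \<le> (\<Sum>j\<in>v. A j :: nat)"
  shows "\<exists>b. (\<forall>j\<in>v. b j \<le> A j) \<and> (\<Sum>j\<in>v. b j) = t"
  using assms
proof (induction v arbitrary: t)
  case (insert i v)
  show ?case
  proof (cases "t \<le> (\<Sum>j\<in>v. A j)")
    case True
    then obtain b where b: "\<forall>j\<in>v. b j \<le> A j" "(\<Sum>j\<in>v. b j) = t" using insert by blast
    have "(\<Sum>j\<in>v. (b(i := 0)) j) = t" using insert b(2) by (auto intro: sum.cong)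
    then show ?thesis using insert b by (intro exI[of _ "b(i := 0)"]) auto
  next
    case False
    then have "t - (\<Sum>j\<in>v. A j) \<le> A i" using insert by simp
    moreover have "(\<Sum>j\<in>v. (A(i := t - (\<Sum>j\<in>v. A j))) j) = (\<Sum>j\<in>v. A j)"
      using insert by (auto intro: sum.cong)
    ultimately show ?thesis using insert False by (intro exI[of _ "A(i := t - (\<Sum>j\<in>v. A j))"]) auto
  qed
qed auto

text \<open>Bounds the sum over one class of points, up to the factor \<open>2 X \<rho> powr - q\<close>, by the sum \<open>n\<close>
  of its dyadic levels; here \<open>x = 2 powr (1 - q)\<close> and \<open>X = 1 / (1 - x)\<close>.\<close>

definition level_factor :: "real \<Rightarrow> nat \<Rightarrow> nat \<Rightarrow> real" where
  "level_factor x t n = (if n \<le> t then 1 else x ^ (n - t - 1))"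

text \<open>The dyadic size \<open>2 ^ A j\<close> is prescribed in all coordinates but \<open>i\<close>. Leaving that coordinate
  free is what keeps the dependence on the dimension down to \<open>(t + 2) ^ (card u - 1)\<close>.\<close>

locale dyadic_class =
  fixes u :: "nat set" and i :: nat and \<rho> q :: real and A :: "nat \<Rightarrow> nat" and t :: nat
    and T :: "(nat \<Rightarrow> int) set"
  assumes u: "finite u" "i \<in> u" and T: "finite T"
    and ext: "\<And>k. k \<in> T \<Longrightarrow> k \<in> extensional u"
    and nonzero: "\<And>k j. k \<in> T \<Longrightarrow> j \<in> u \<Longrightarrow> k j \<noteq> 0"
    and sign: "\<And>k k' j. k \<in> T \<Longrightarrow> k' \<in> T \<Longrightarrow> j \<in> u \<Longrightarrow> (k j > 0) = (k' j > 0)"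
    and level: "\<And>k j. k \<in> T \<Longrightarrow> j \<in> u - {i} \<Longrightarrow> 2 ^ A j \<le> \<bar>k j\<bar> \<and> \<bar>k j\<bar> < 2 ^ (A j + 1)"
    and sep: "separated u \<rho> T"
    and min: "\<And>k. k \<in> T \<Longrightarrow> \<rho> \<le> (\<Prod>j\<in>u. \<bar>real_of_int (k j)\<bar>)"
    and \<rho>: "2 ^ t \<le> \<rho>" "\<rho> < 2 ^ (t + 1)"
    and q: "q > 1"
begin

text \<open>\<open>2 ^ m\<close> is the volume of the dyadic box in the coordinates other than
  \<open>i\<close>; its comparison with \<open>2 ^ t\<close> decides between the two estimates
  below.\<close>

definition "m = (\<Sum>j\<in>u - {i}. A j)"
definition "X = 1 / (1 - 2 powr (1 - q))"
definition "w k = (\<Prod>j\<in>u. \<bar>real_of_int (k j)\<bar> powr (- q))" for k :: "nat \<Rightarrow> int"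

lemma \<rho>_pos: "\<rho> > 0"
  using \<rho>(1) by (smt (verit) zero_less_power)

lemma X_ge_1: "X \<ge> 1"
  using q powr_less_mono[of "1 - q" 0 "2 :: real"] by (auto simp: X_def field_simps)

lemma w_eq: "w k = (\<Prod>j\<in>u. \<bar>real_of_int (k j)\<bar>) powr (- q)"
  by (simp add: w_def prod_powr_distrib)

lemma norm_ge:
  assumes "k \<in> T"
  shows "\<bar>real_of_int (k i)\<bar> * 2 ^ m \<le> (\<Prod>j\<in>u. \<bar>real_of_int (k j)\<bar>)"
proof -
  have "2 ^ A j \<le> \<bar>real_of_int (k j)\<bar>" if "j \<in> u - {i}" for j
  proof -
    have "real_of_int (2 ^ A j) \<le> real_of_int \<bar>k j\<bar>"
      using level[OF assms that] by (simp only: of_int_le_iff)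
    then show ?thesis by simp
  qed
  then have "(\<Prod>j\<in>u - {i}. 2 ^ A j) \<le> (\<Prod>j\<in>u - {i}. \<bar>real_of_int (k j)\<bar>)"
    by (intro prod_mono) auto
  then show ?thesis
    using u by (simp add: prod.remove[of u i] m_def power_sum mult_left_mono)
qed

text \<open>Here points of the class differ by at least \<open>\<rho> / 2 ^ m\<close> in the coordinate \<open>i\<close>, so they are
  numbered injectively by \<open>\<lfloor>\<bar>k i\<bar> * 2 ^ m / \<rho>\<rfloor>\<close>.\<close>

lemma sum_low:
  assumes "m \<le> t"
  shows "sum w T \<le> \<rho> powr (- q) * (2 * X)"
proof -
  define f where "f = (\<lambda>k::nat \<Rightarrow> int. nat \<lfloor>\<bar>real_of_int (k i)\<bar> * 2 ^ m / \<rho>\<rfloor>)"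
  \<comment> \<open>At index \<open>0\<close> the coordinate \<open>i\<close> gives no information
    and \<open>min\<close> is used instead, whence the value \<open>1\<close>. The total
    \<open>1 + X\<close> is at most \<open>2 * X\<close>.\<close>
  define \<phi> where "\<phi> = (\<lambda>n. if n = 0 then 1 else real n powr (- q))"
  have 2: "(2::real) ^ m \<le> \<rho>"
    using assms \<rho>(1) power_increasing[of m t "2::real"] by linarith
  have inj: "inj_on f T"
  proof (rule inj_onI, rule ccontr)
    fix k k' assume k: "k \<in> T" "k' \<in> T" "f k = f k'" "k \<noteq> k'"
    have "\<bar>k j - k' j\<bar> < 2 ^ A j" if "j \<in> u - {i}" for j
      using level[OF k(1) that] level[OF k(2) that] abs_diff_same_sign[OF sign[OF k(1,2)]]
        nonzero k that by fastforce
    then have *: "if k i = k' i then \<rho> < 2 ^ m else \<rho> \<le> \<bar>real_of_int (k i - k' i)\<bar> * 2 ^ m"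
      using separated_gap[OF sep k(1,2,4) u, of A m] ext k by (auto simp: m_def)
    then have "k i \<noteq> k' i" using 2 by auto
    then have "\<rho> \<le> \<bar>real_of_int (k i - k' i)\<bar> * 2 ^ m" using * by simp
    moreover have "real_of_int \<bar>k i - k' i\<bar> = real_of_int \<bar>\<bar>k i\<bar> - \<bar>k' i\<bar>\<bar>"
      using abs_diff_same_sign[OF sign[OF k(1,2) u(2)]] nonzero k u by simp
    ultimately have "1 \<le> \<bar>\<bar>real_of_int (k i)\<bar> - \<bar>real_of_int (k' i)\<bar>\<bar> * 2 ^ m / \<rho>"
      using \<rho>_pos by (simp add: field_simps)
    also have "\<dots> = \<bar>\<bar>real_of_int (k i)\<bar> * 2 ^ m / \<rho> - \<bar>real_of_int (k' i)\<bar> * 2 ^ m / \<rho>\<bar>"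
      using \<rho>_pos by (simp add: abs_mult left_diff_distrib[symmetric] diff_divide_distrib[symmetric])
    finally have "\<lfloor>\<bar>real_of_int (k i)\<bar> * 2 ^ m / \<rho>\<rfloor> \<noteq> \<lfloor>\<bar>real_of_int (k' i)\<bar> * 2 ^ m / \<rho>\<rfloor>"
      by linarith
    moreover have "\<lfloor>\<bar>real_of_int (k i)\<bar> * 2 ^ m / \<rho>\<rfloor> \<ge> 0" for k :: "nat \<Rightarrow> int"
      using \<rho>_pos by simp
    ultimately show False using k(3) by (simp add: f_def eq_nat_nat_iff)
  qed
  have w: "w k \<le> \<rho> powr (- q) * \<phi> (f k)" if "k \<in> T" for k
  proof (cases "f k = 0")
    case True
    then show ?thesis
      using min[OF that] q \<rho>_pos by (simp add: w_eq \<phi>_def powr_mono2')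
  next
    case False
    have "real (f k) \<le> \<bar>real_of_int (k i)\<bar> * 2 ^ m / \<rho>"
      unfolding f_def using \<rho>_pos by simp
    then have "\<rho> * real (f k) \<le> \<bar>real_of_int (k i)\<bar> * 2 ^ m"
      using \<rho>_pos by (simp add: field_simps)
    also note norm_ge[OF that]
    finally have "w k \<le> (\<rho> * real (f k)) powr (- q)"
      using False \<rho>_pos q by (auto simp: w_eq intro!: powr_mono2')
    then show ?thesis using False \<rho>_pos by (simp add: \<phi>_def powr_mult)
  qed
  have "sum \<phi> (f ` T) \<le> sum \<phi> (insert 0 (f ` T - {0}))"
    using T by (intro sum_mono2) (auto simp: \<phi>_def)
  also have "\<dots> = 1 + (\<Sum>n\<in>f ` T - {0}. real n powr (- q))"
    using T by (subst sum.insert) (auto simp: \<phi>_def intro: sum.cong)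
  also have "(\<Sum>n\<in>f ` T - {0}. real n powr (- q)) \<le> X"
    unfolding X_def using T q by (intro sum_powr_le_geometric) auto
  finally have \<phi>: "sum \<phi> (f ` T) \<le> 2 * X"
    using X_ge_1 by simp
  have "sum w T \<le> (\<Sum>k\<in>T. \<rho> powr (- q) * \<phi> (f k))" by (intro sum_mono w)
  also have "\<dots> = \<rho> powr (- q) * sum \<phi> (f ` T)"
    using inj by (simp add: sum.reindex sum_distrib_left)
  also have "\<dots> \<le> \<rho> powr (- q) * (2 * X)"
    using \<phi> by (intro mult_left_mono) auto
  finally show ?thesis .
qed

text \<open>Here the box is cut into \<open>2 ^ (m - t)\<close> boxes of volume \<open>2 ^ t \<le> \<rho>\<close>, each of which contains at
  most one point with a given value of \<open>k i\<close>.\<close>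

lemma sum_high:
  assumes m: "m > t"
  shows "sum w T \<le> \<rho> powr (- q) * (2 * X * (2 powr (1 - q)) ^ (m - t - 1))"
proof -
  define v where "v = u - {i}"
  have v: "finite v" "i \<notin> v" "u = insert i v" using u by (auto simp: v_def)
  obtain b where b: "\<And>j. j \<in> v \<Longrightarrow> b j \<le> A j" "(\<Sum>j\<in>v. b j) = t"
    using exists_smaller_exponents[OF v(1), of t A] m by (auto simp: m_def v_def)
  \<comment> \<open>Signs are constant on \<open>T\<close>, so passing to absolute values loses
    nothing.\<close>
  define f where "f = (\<lambda>k::nat \<Rightarrow> int. (nat \<bar>k i\<bar>, \<lambda>j\<in>v. \<bar>k j\<bar> div 2 ^ b j))"
  define Y where "Y = (\<lambda>k. nat \<bar>k i\<bar>) ` T"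
  define H where "H = (PiE v (\<lambda>j. {2 ^ (A j - b j) ..< 2 ^ (A j - b j + 1) :: int}))"
  have inj: "inj_on f T"
  proof (rule inj_onI, rule ccontr)
    fix k k' assume k: "k \<in> T" "k' \<in> T" "f k = f k'" "k \<noteq> k'"
    have "\<bar>k j - k' j\<bar> < 2 ^ b j" if "j \<in> u - {i}" for j
    proof (rule abs_diff_less_of_div_eq)
      have "j \<in> v" using that by (simp add: v_def)
      then show "\<bar>k j\<bar> div 2 ^ b j = \<bar>k' j\<bar> div 2 ^ b j"
        using fun_cong[OF arg_cong[OF k(3), of snd], of j] by (simp add: f_def)
    qed (use sign[OF k(1,2)] nonzero k that in auto)
    then have *: "if k i = k' i then \<rho> < 2 ^ t else \<rho> \<le> \<bar>real_of_int (k i - k' i)\<bar> * 2 ^ t"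
      using separated_gap[OF sep k(1,2,4) u, of b t] ext k b by (auto simp: v_def)
    have "\<bar>k i\<bar> = \<bar>k' i\<bar>" using arg_cong[OF k(3), of fst] by (simp add: f_def)
    then have "k i = k' i"
      using sign[OF k(1,2) u(2)] nonzero[OF k(1) u(2)] nonzero[OF k(2) u(2)] by linarith
    with * \<rho>(1) show False by simp
  qed
  have sub: "f ` T \<subseteq> Y \<times> H"
  proof -
    have "\<bar>k j\<bar> div 2 ^ b j \<in> {2 ^ (A j - b j) ..< 2 ^ (A j - b j + 1)}" if "k \<in> T" "j \<in> v" for k j
    proof -
      have "2 ^ (A j - b j) * 2 ^ b j = (2::int) ^ A j" "2 ^ (A j - b j + 1) * 2 ^ b j = (2::int) ^ (A j + 1)"
        using b(1)[OF that(2)] by (simp_all flip: power_add)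
      moreover have "2 ^ A j \<le> \<bar>k j\<bar>" "\<bar>k j\<bar> < 2 ^ (A j + 1)"
        using level[OF that(1), of j] that(2) by (auto simp: v_def)
      ultimately have "2 ^ (A j - b j) * 2 ^ b j \<le> \<bar>k j\<bar>" "\<bar>k j\<bar> < 2 ^ (A j - b j + 1) * 2 ^ b j"
        by metis+
      then show ?thesis
        by (simp add: le_div_iff_int not_le[symmetric] del: not_le)
    qed
    then show ?thesis by (auto simp: f_def Y_def H_def)
  qed
  have fin: "finite Y" "finite H" using T v by (auto simp: Y_def H_def intro!: finite_PiE)
  have w: "w k \<le> 2 powr (- q * real m) * real (fst (f k)) powr (- q)" if "k \<in> T" for k
  proof -
    have "w k \<le> (\<bar>real_of_int (k i)\<bar> * 2 ^ m) powr (- q)"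
      using nonzero[OF that u(2)] q norm_ge[OF that] by (auto simp: w_eq intro!: powr_mono2')
    also have "\<dots> = 2 powr (- q * real m) * real (fst (f k)) powr (- q)"
      by (simp add: powr_mult f_def powr_powr mult.commute flip: powr_realpow)
    finally show ?thesis .
  qed
  have cardH: "real (card H) = 2 ^ (m - t)"
  proof -
    have "card H = (\<Prod>j\<in>v. 2 ^ (A j - b j))"
      using v by (simp add: H_def card_PiE nat_diff_distrib nat_power_eq)
    also have "\<dots> = 2 ^ (\<Sum>j\<in>v. A j - b j)" by (simp add: power_sum)
    also have "(\<Sum>j\<in>v. A j - b j) = m - t"
      unfolding m_def v_def[symmetric] b(2)[symmetric] using b(1) by (rule sum_subtractf_nat)
    finally show ?thesis by simp
  qed
  have "sum w T \<le> (\<Sum>k\<in>T. 2 powr (- q * real m) * real (fst (f k)) powr (- q))"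
    by (intro sum_mono w)
  also have "\<dots> = (\<Sum>p\<in>f ` T. 2 powr (- q * real m) * real (fst p) powr (- q))"
    using inj by (simp add: sum.reindex)
  also have "\<dots> \<le> (\<Sum>p\<in>Y \<times> H. 2 powr (- q * real m) * real (fst p) powr (- q))"
    using sub fin by (intro sum_mono2) auto
  also have "\<dots> = 2 powr (- q * real m) * (2 ^ (m - t) * (\<Sum>y\<in>Y. real y powr (- q)))"
    by (simp only: sum.cartesian_product' fst_conv sum_constant cardH, simp only: sum_distrib_left, simp only: mult_ac)
  also have "\<dots> \<le> 2 powr (- q * real m) * (2 ^ (m - t) * X)"
    unfolding X_def using fin q nonzero u
    by (intro mult_left_mono sum_powr_le_geometric) (auto simp: Y_def)
  \<comment> \<open>The power is split at \<open>t + 1\<close> and not at \<open>t\<close>, because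
    \<open>\<rho> < 2 ^ (t + 1)\<close> is the inequality that a negative exponent requires. This
    causes the \<open>- 1\<close> in \<open>level_factor\<close>.\<close>
  also have "\<dots> = (2 ^ (t + 1)) powr (- q) * (2 * X * (2 powr (1 - q)) ^ (m - t - 1))"
  proof -
    define n where "n = m - t - 1"
    have n: "m = n + t + 1" using m by (simp add: n_def)
    have "(2 ^ (t + 1)) powr (- q) = (2::real) powr (- q * real (t + 1))"
      by (simp only: powr_realpow[symmetric] zero_less_numeral powr_powr mult.commute)
    moreover have "(2 powr (1 - q)) ^ n = (2::real) powr ((1 - q) * real n)"
      by (simp add: powr_power mult.commute)
    moreover have "(2::real) ^ (m - t) = 2 * 2 powr real n"
      by (simp add: n powr_realpow)
    moreover have "2 powr (- q * real m) * 2 powr real n = 2 powr (- q * real (t + 1)) * 2 powr ((1 - q) * real n)"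
      by (simp add: n algebra_simps flip: powr_add)
    ultimately show ?thesis unfolding n_def[symmetric] by simp
  qed
  also have "\<dots> \<le> \<rho> powr (- q) * (2 * X * (2 powr (1 - q)) ^ (m - t - 1))"
    using \<rho> \<rho>_pos q X_ge_1 by (intro mult_right_mono powr_mono2') auto
  finally show ?thesis .
qed

theorem class_sum_le:
  "(\<Sum>k\<in>T. \<Prod>j\<in>u. \<bar>real_of_int (k j)\<bar> powr (- q)) \<le>
     \<rho> powr (- q) * (2 / (1 - 2 powr (1 - q)) * level_factor (2 powr (1 - q)) t (\<Sum>j\<in>u - {i}. A j))"
  using sum_low sum_high
  by (cases "m \<le> t") (simp_all add: level_factor_def flip: m_def w_def, simp_all add: X_def)

end

text \<open>At most \<open>t + 1\<close> levels lie in the flat part, and the geometric tail adds at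
  most \<open>1 / (1 - x)\<close>; since \<open>1 \<le> 1 / (1 - x)\<close>, together they give the
  numerator \<open>t + 2\<close>.\<close>

lemma sum_level_factor_le:
  assumes x: "0 \<le> x" "x < 1"
  shows "(\<Sum>a\<le>M. level_factor x t (n + a)) \<le> (real t + 2) / (1 - x) * level_factor x t n"
proof -
  have X: "1 \<le> 1 / (1 - x)" using x by (simp add: field_simps)
  show ?thesis
  proof (cases "n \<le> t")
    case False
    have "(\<Sum>a\<le>M. level_factor x t (n + a)) = (\<Sum>a\<le>M. x ^ a) * level_factor x t n"
      using False by (auto simp: level_factor_def sum_distrib_right add.commute simp flip: power_add intro!: sum.cong)
    also have "\<dots> \<le> 1 / (1 - x) * level_factor x t n"
      using x by (intro mult_right_mono sum_geometric_le) (auto simp: level_factor_def)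
    also have "\<dots> \<le> (real t + 2) / (1 - x) * level_factor x t n"
      using x by (intro mult_right_mono divide_right_mono) (auto simp: level_factor_def)
    finally show ?thesis .
  next
    case True
    have "(\<Sum>a\<le>M. level_factor x t (n + a)) = (\<Sum>k\<in>{n..n + M}. level_factor x t k)"
      by (rule sum.reindex_bij_witness[of _ "\<lambda>k. k - n" "\<lambda>a. n + a"]) auto
    also have "\<dots> = (\<Sum>k\<in>{n..n + M} \<inter> {..t}. level_factor x t k) + (\<Sum>k\<in>{n..n + M} - {..t}. level_factor x t k)"
      by (rule sum.Int_Diff) auto
    also have "(\<Sum>k\<in>{n..n + M} \<inter> {..t}. level_factor x t k) \<le> real (card {..t})"
      using card_mono[of "{..t}" "{n..n + M} \<inter> {..t}"] by (simp add: level_factor_def)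
    also have "(\<Sum>k\<in>{n..n + M} - {..t}. level_factor x t k) = (\<Sum>k\<in>(\<lambda>k. k - t - 1) ` ({n..n + M} - {..t}). x ^ k)"
      by (subst sum.reindex) (auto simp: level_factor_def inj_on_def)
    also have "\<dots> \<le> 1 / (1 - x)" using x by (intro sum_geometric_le) auto
    also have "real (card {..t}) + 1 / (1 - x) \<le> (real t + 2) / (1 - x)"
      using mult_left_mono[OF X, of "real t + 1"] by (simp add: algebra_simps add_divide_distrib)
    finally show ?thesis using True by (simp add: level_factor_def)
  qed
qed

text \<open>The offset \<open>n\<close> carries the induction: a fixed exponent \<open>a\<close> of
  the new coordinate is absorbed into it, and the remaining sum over \<open>a\<close> is the
  one-coordinate case.\<close>

lemma sum_levels_le:
  assumes x: "0 \<le> x" "x < 1" and "finite v"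
  shows "(\<Sum>A\<in>v \<rightarrow>\<^sub>E {..M}. level_factor x t (n + (\<Sum>j\<in>v. A j)))
       \<le> ((real t + 2) / (1 - x)) ^ card v * level_factor x t n"
  using assms(3)
proof (induction v arbitrary: n)
  case (insert i v)
  have sm: "(\<Sum>j\<in>insert i v. (A(i := a)) j) = a + (\<Sum>j\<in>v. A j)" for A :: "'a \<Rightarrow> nat" and a
  proof -
    have "(\<Sum>j\<in>v. (A(i := a)) j) = (\<Sum>j\<in>v. A j)" using insert by (intro sum.cong) auto
    then show ?thesis using insert by simp
  qed
  have "(\<Sum>A\<in>insert i v \<rightarrow>\<^sub>E {..M}. level_factor x t (n + (\<Sum>j\<in>insert i v. A j)))
      = (\<Sum>a\<le>M. \<Sum>A\<in>v \<rightarrow>\<^sub>E {..M}. level_factor x t ((n + a) + (\<Sum>j\<in>v. A j)))"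
    by (subst sum_PiE_insert[OF insert(2)], subst sum.swap) (simp only: sm add.assoc)
  also have "\<dots> \<le> (\<Sum>a\<le>M. ((real t + 2) / (1 - x)) ^ card v * level_factor x t (n + a))"
    by (intro sum_mono insert.IH)
  also have "\<dots> = ((real t + 2) / (1 - x)) ^ card v * (\<Sum>a\<le>M. level_factor x t (n + a))"
    by (simp add: sum_distrib_left)
  also have "\<dots> \<le> ((real t + 2) / (1 - x)) ^ card v * ((real t + 2) / (1 - x) * level_factor x t n)"
    using x by (intro mult_left_mono sum_level_factor_le) auto
  finally show ?case using insert by (simp add: mult_ac)
qed simp

section \<open>Sums over the whole dual set\<close>

lemma separated_subset: "separated u \<rho> F \<Longrightarrow> F' \<subseteq> F \<Longrightarrow> separated u \<rho> F'"
  by (auto simp: separated_def)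

text \<open>Classes are given by the signs of all coordinates and the dyadic levels of all but
  \<open>i\<close>. The signs cost \<open>2 ^ card u\<close>, a class costs \<open>2 * X\<close>,
  and the levels cost \<open>((real t + 2) * X) ^ (card u - 1)\<close>.\<close>

lemma sum_separated_le:
  assumes u: "finite u" "i \<in> u" and F: "finite F"
    and ext: "\<And>k. k \<in> F \<Longrightarrow> k \<in> extensional u"
    and nonzero: "\<And>k j. k \<in> F \<Longrightarrow> j \<in> u \<Longrightarrow> k j \<noteq> 0"
    and sep: "separated u \<rho> F"
    and min: "\<And>k. k \<in> F \<Longrightarrow> \<rho> \<le> (\<Prod>j\<in>u. \<bar>real_of_int (k j)\<bar>)"
    and \<rho>: "2 ^ t \<le> \<rho>" "\<rho> < 2 ^ (t + 1)"
    and q: "q > 1"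
  defines "X \<equiv> 1 / (1 - 2 powr (1 - q))"
  shows "(\<Sum>k\<in>F. \<Prod>j\<in>u. \<bar>real_of_int (k j)\<bar> powr (- q))
       \<le> \<rho> powr (- q) * (2 * (2 * X) ^ card u * (real t + 2) ^ (card u - 1))"
proof -
  define v where "v = u - {i}"
  have v: "finite v" "card v = card u - 1" "card u = Suc (card v)"
    using u by (auto simp: v_def card_Diff_singleton) (metis Suc_pred card_gt_0_iff empty_iff)
  let ?x = "(2::real) powr (1 - q)"
  have x: "0 \<le> ?x" "?x < 1"
    using q powr_less_mono[of "1 - q" 0 "2 :: real"] by auto
  then have X: "X > 0" by (simp add: X_def)
  let ?w = "\<lambda>k. \<Prod>j\<in>u. \<bar>real_of_int (k j)\<bar> powr (- q)"
  define lev where "lev = (\<lambda>y::int. floor_log (nat \<bar>y\<bar>))"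
  have lev: "2 ^ lev y \<le> \<bar>y\<bar>" "\<bar>y\<bar> < 2 ^ (lev y + 1)" if "y \<noteq> 0" for y
  proof -
    have "int (2 ^ lev y) \<le> int (nat \<bar>y\<bar>)"
      unfolding lev_def of_nat_le_iff using that by (intro floor_log_exp2_le) auto
    then show "2 ^ lev y \<le> \<bar>y\<bar>" by simp
    have "int (nat \<bar>y\<bar>) < int (2 * 2 ^ lev y)"
      unfolding lev_def of_nat_less_iff by (rule floor_log_exp2_gt)
    then show "\<bar>y\<bar> < 2 ^ (lev y + 1)" by simp
  qed
  \<comment> \<open>\<open>M\<close> merely makes the set of levels finite; the bound for the sum
    over levels does not depend on it.\<close>
  define M where "M = Max (\<Union>k\<in>F. (\<lambda>j. lev (k j)) ` v)"
  have M: "lev (k j) \<le> M" if "k \<in> F" "j \<in> v" for k j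
    unfolding M_def using that F v by (intro Max_ge) auto
  define g where "g = (\<lambda>k. (\<lambda>j\<in>u. k j > 0, \<lambda>j\<in>v. lev (k j)))"
  let ?S = "u \<rightarrow>\<^sub>E (UNIV :: bool set)" and ?L = "v \<rightarrow>\<^sub>E {..M}"
  have gF: "g ` F \<subseteq> ?S \<times> ?L" using M by (auto simp: g_def)
  have fin: "finite (?S \<times> ?L)" using u v by (auto intro!: finite_PiE)
  have cls: "sum ?w {k\<in>F. g k = (\<sigma>, A)} \<le> \<rho> powr (- q) * (2 * X * level_factor ?x t (\<Sum>j\<in>v. A j))" for \<sigma> A
  proof -
    let ?T = "{k\<in>F. g k = (\<sigma>, A)}"
    have g: "(k j > 0) = \<sigma> j" "j \<noteq> i \<Longrightarrow> lev (k j) = A j" if "k \<in> ?T" "j \<in> u" for k j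
      using that by (auto simp: g_def v_def)
    have "dyadic_class u i \<rho> q A t ?T"
    proof
      fix k k' j assume "k \<in> ?T" "k' \<in> ?T" "j \<in> u"
      then show "(k j > 0) = (k' j > 0)" using g(1) by simp
    next
      fix k j assume k: "k \<in> ?T" "j \<in> u - {i}"
      then have "k j \<noteq> 0" "lev (k j) = A j" using nonzero g(2)[of k j] by auto
      then show "2 ^ A j \<le> \<bar>k j\<bar> \<and> \<bar>k j\<bar> < 2 ^ (A j + 1)" using lev[of "k j"] by simp
    next
      show "separated u \<rho> ?T" by (rule separated_subset[OF sep]) simp
    next
      show "k \<in> extensional u" "\<rho> \<le> (\<Prod>j\<in>u. \<bar>real_of_int (k j)\<bar>)" if "k \<in> ?T" for k
        using ext min that by blast+
    next
      show "k j \<noteq> 0" if "k \<in> ?T" "j \<in> u" for k j using nonzero that by blast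
    qed (use u F \<rho> q in simp_all)
    from dyadic_class.class_sum_le[OF this] show ?thesis
      by (simp add: X_def v_def)
  qed
  have "sum ?w F = (\<Sum>p\<in>?S \<times> ?L. sum ?w {k\<in>F. g k = p})"
    by (rule sum.group[symmetric]) (use F fin gF in auto)
  also have "\<dots> \<le> (\<Sum>(\<sigma>, A)\<in>?S \<times> ?L. \<rho> powr (- q) * (2 * X * level_factor ?x t (\<Sum>j\<in>v. A j)))"
    using cls by (intro sum_mono) auto
  also have "\<dots> = real (card ?S) * (\<rho> powr (- q) * (2 * X * (\<Sum>A\<in>?L. level_factor ?x t (\<Sum>j\<in>v. A j))))"
    by (simp add: sum.cartesian_product[symmetric] sum_distrib_left)
  also have "\<dots> \<le> real (card ?S) * (\<rho> powr (- q) * (2 * X * ((real t + 2) / (1 - ?x)) ^ card v))"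
    using sum_levels_le[OF x v(1), of t 0 M] X
    by (intro mult_left_mono) (auto simp: level_factor_def)
  also have "real (card ?S) = 2 ^ card u" using u by (simp add: card_PiE)
  also have "(real t + 2) / (1 - ?x) = (real t + 2) * X" by (simp add: X_def)
  also have "2 ^ card u * (\<rho> powr (- q) * (2 * X * ((real t + 2) * X) ^ card v))
     = \<rho> powr (- q) * (2 * (2 * X) ^ card u * (real t + 2) ^ (card u - 1))"
    by (simp add: v(3) power_mult_distrib)
  finally show ?thesis .
qed

text \<open>Members of a dual set have no zero entries, so the difference is restricted to the
  coordinates where it does not vanish; the congruence does not notice the dropped terms.\<close>

lemma separated_dual_set:
  assumes min: "\<And>v k. v \<noteq> {} \<Longrightarrow> v \<subseteq> u \<Longrightarrow> k \<in> dual_set N z v \<Longrightarrow> \<rho> \<le> (\<Prod>j\<in>v. \<bar>real_of_int (k j)\<bar>)"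
    and u: "finite u"
  shows "separated u \<rho> (dual_set N z u)"
  unfolding separated_def
proof (intro ballI impI)
  fix k k' assume k: "k \<in> dual_set N z u" "k' \<in> dual_set N z u" "k \<noteq> k'"
  let ?D = "{j\<in>u. k j \<noteq> k' j}" and ?d = "\<lambda>j\<in>{j\<in>u. k j \<noteq> k' j}. k j - k' j"
  have ne: "?D \<noteq> {}"
  proof
    assume "?D = {}"
    then have "\<forall>j\<in>u. k j = k' j" by auto
    with k show False by (auto simp: dual_set_def PiE_def intro: extensionalityI)
  qed
  have "(\<Sum>j\<in>?D. ?d j * int (z j)) = (\<Sum>j\<in>?D. k j * int (z j) - k' j * int (z j))"
    by (intro sum.cong) (auto simp: algebra_simps)
  also have "\<dots> = (\<Sum>j\<in>u. k j * int (z j) - k' j * int (z j))"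
    using u by (intro sum.mono_neutral_left) auto
  also have "\<dots> = (\<Sum>j\<in>u. k j * int (z j)) - (\<Sum>j\<in>u. k' j * int (z j))"
    by (rule sum_subtractf)
  also have "[\<dots> = 0 - 0] (mod int N)"
    using k by (intro cong_diff) (auto simp: dual_set_def)
  finally have "?d \<in> dual_set N z ?D" by (auto simp: dual_set_def)
  from min[OF ne _ this] have "\<rho> \<le> (\<Prod>j\<in>?D. \<bar>real_of_int (?d j)\<bar>)" by auto
  also have "\<dots> = (\<Prod>j\<in>?D. \<bar>real_of_int (k j - k' j)\<bar>)" by (intro prod.cong) auto
  finally show "\<rho> \<le> (\<Prod>j\<in>?D. \<bar>real_of_int (k j - k' j)\<bar>)" .
qed

theorem dual_sum_le:
  assumes min: "\<And>v k. v \<noteq> {} \<Longrightarrow> v \<subseteq> u \<Longrightarrow> k \<in> dual_set N z v \<Longrightarrow> \<rho> \<le> (\<Prod>j\<in>v. \<bar>real_of_int (k j)\<bar>)"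
    and u: "finite u" "u \<noteq> {}" and N: "N \<ge> 2" and z: "\<And>j. j \<in> u \<Longrightarrow> z j \<in> {1..N - 1}"
    and \<rho>: "\<rho> > 0" and q: "q > 1"
  shows "dual_sum q N z u \<le> \<rho> powr (- q) * ((4 / (1 - 2 powr (1 - q))) ^ card u * log 2 (real N) ^ (card u - 1))"
proof -
  define X where "X = 1 / (1 - (2::real) powr (1 - q))"
  have X: "X > 0" using q powr_less_mono[of "1 - q" 0 "2 :: real"] by (simp add: X_def)
  define L where "L = log 2 (real N)"
  have L: "L \<ge> 1" using N by (simp add: L_def le_log_iff)
  \<comment> \<open>Nonzero integers have a product of absolute value at least \<open>1\<close>, so
    a smaller \<open>\<rho>\<close> can be raised to \<open>1\<close>. Then
    \<open>2 ^ t \<le> r < 2 ^ (t + 1)\<close> holds for a natural number \<open>t\<close>.\<close>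
  define r where "r = max 1 \<rho>"
  have min': "r \<le> (\<Prod>j\<in>v. \<bar>real_of_int (k j)\<bar>)" if "v \<noteq> {}" "v \<subseteq> u" "k \<in> dual_set N z v" for v k
  proof -
    have "1 \<le> (\<Prod>j\<in>v. \<bar>real_of_int (k j)\<bar>)"
      using that(3) by (intro prod_ge_1) (auto simp: dual_set_def PiE_iff)
    then show ?thesis using min[OF that] by (simp add: r_def)
  qed
  define t where "t = floor_log (nat \<lfloor>r\<rfloor>)"
  have n: "nat \<lfloor>r\<rfloor> > 0" "real (nat \<lfloor>r\<rfloor>) \<le> r" "r < real (nat \<lfloor>r\<rfloor>) + 1"
    by (auto simp: r_def le_max_iff_disj) linarith+
  have t: "2 ^ t \<le> r" "r < 2 ^ (t + 1)"
  proof -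
    have "real (2 ^ t) \<le> real (nat \<lfloor>r\<rfloor>)"
      unfolding t_def of_nat_le_iff using n by (intro floor_log_exp2_le) auto
    then show "2 ^ t \<le> r" using n(2) by (simp only: of_nat_power of_nat_numeral)
    have "nat \<lfloor>r\<rfloor> + 1 \<le> 2 ^ (t + 1)"
      using floor_log_exp2_gt[of "nat \<lfloor>r\<rfloor>"] by (simp add: t_def)
    then have "real (nat \<lfloor>r\<rfloor> + 1) \<le> real (2 ^ (t + 1))" by (simp only: of_nat_le_iff)
    then have "real (nat \<lfloor>r\<rfloor>) + 1 \<le> 2 ^ (t + 1)"
      by (simp only: of_nat_power of_nat_numeral of_nat_add of_nat_1)
    with n(3) show "r < 2 ^ (t + 1)" by (rule less_le_trans)
  qed
  obtain i where i: "i \<in> u" using u by blast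
  \<comment> \<open>For \<open>N \<ge> 4\<close> the dual vector with the single entry \<open>N\<close> gives \<open>r \<le> N\<close>; for \<open>N = 2, 3\<close> that is too
    weak, but then some dual vector has entries \<open>1\<close> and \<open>\<plusminus>1\<close>.\<close>
  have tL: "(real t + 2) ^ (card u - 1) \<le> (2 * L) ^ (card u - 1)"
  proof (cases "card u = 1")
    \<comment> \<open>For \<open>card u = 1\<close> the exponent is \<open>0\<close> and
      \<open>t\<close> is irrelevant; there \<open>t + 2 \<le> 2 * L\<close> may fail, for instance
      with \<open>N = 2\<close> and \<open>r = 2\<close>. The second coordinate now available
      repairs this for small \<open>N\<close>.\<close>
    case False
    have "real t + 2 \<le> 2 * L"
    proof (cases "N \<ge> 4")
      case True
      have "(\<lambda>j\<in>{i}. int N) \<in> dual_set N z {i}" using N by (auto simp: dual_set_def cong_0_iff)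
      from min'[OF _ _ this] have "r \<le> real N" using i by simp
      then have "2 ^ t \<le> real N" using t(1) by linarith
      then have "2 powr real t \<le> real N" by (simp only: powr_realpow zero_less_numeral)
      then have "real t \<le> L" using N by (simp add: L_def le_log_iff)
      moreover have "2 \<le> L" using True by (simp add: L_def le_log_iff)
      ultimately show ?thesis by simp
    next
      case F: False
      obtain j where j: "j \<in> u" "j \<noteq> i"
        using False u i by (metis card_1_singleton_iff One_nat_def is_singletonI' is_singleton_altdef)
      have "z i = z j \<or> z i + z j = N" using z[OF i] z[OF j(1)] F by auto
      then obtain e :: int where e: "\<bar>e\<bar> = 1" "int N dvd int (z i) + e * int (z j)"
      proof
        assume "z i = z j"
        then show ?thesis using that[of "-1"] by simp
      next
        assume "z i + z j = N"
        then have "int (z i) + 1 * int (z j) = int N" by linarith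
        then show ?thesis using that[of 1] by simp
      qed
      have "(\<lambda>l\<in>{i, j}. if l = i then 1 else e) \<in> dual_set N z {i, j}"
        using e j by (auto simp: dual_set_def cong_0_iff)
      from min'[OF _ _ this] have "r \<le> 1" using i j e by simp
      then have "(2::real) ^ t \<le> 1" using t(1) by linarith
      then have "t = 0" by (simp add: power_le_one_iff)
      then show ?thesis using L by simp
    qed
    then show ?thesis by (intro power_mono) auto
  qed simp
  have "dual_sum q N z u \<le> r powr (- q) * (2 * (2 * X) ^ card u * (real t + 2) ^ (card u - 1))"
    unfolding dual_sum_def
  proof (rule infsum_le_finite_sums)
    fix F assume F: "finite F" "F \<subseteq> dual_set N z u"
    show "(\<Sum>k\<in>F. \<Prod>j\<in>u. \<bar>real_of_int (k j)\<bar> powr (- q))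
       \<le> r powr (- q) * (2 * (2 * X) ^ card u * (real t + 2) ^ (card u - 1))"
      unfolding X_def
    proof (rule sum_separated_le[OF u(1) i F(1) _ _ _ _ t q])
      show "separated u r F"
        by (rule separated_subset[OF separated_dual_set F(2)]) (use min' u in auto)
      show "r \<le> (\<Prod>j\<in>u. \<bar>real_of_int (k j)\<bar>)" if "k \<in> F" for k
        using min'[of u k] F u that by auto
    qed (use F in \<open>auto simp: dual_set_def PiE_iff\<close>)
  qed (rule summable_on_dual_set[OF q u(1)])
  also have "\<dots> \<le> \<rho> powr (- q) * (2 * (2 * X) ^ card u * (2 * L) ^ (card u - 1))"
    using \<rho> q X tL by (intro mult_mono powr_mono2' mult_left_mono) (auto simp: r_def)
  \<comment> \<open>The leading \<open>2\<close> supplies the power of \<open>2\<close> that the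
    exponent \<open>card u - 1\<close> lacks, so every coordinate carries
    \<open>4 * X\<close>.\<close>
  also have "2 * (2 * X) ^ card u * (2 * L) ^ (card u - 1) = (4 * X) ^ card u * L ^ (card u - 1)"
  proof -
    have "card u = Suc (card u - 1)" using u by (simp add: card_gt_0_iff)
    then obtain d where "card u = Suc d" by blast
    then show ?thesis by (simp add: power_mult_distrib flip: power_mult_distrib[of 2 2])
  qed
  finally show ?thesis by (simp add: X_def L_def)
qed

section \<open>Stability of the error bound\<close>

text \<open>Finiteness excludes \<open>c / 0\<close> with \<open>c > 0\<close>, the only case in
  which real division, with value \<open>0\<close>, deviates from the convention.\<close>

lemma weight_ratio_finite:
  assumes "a \<ge> 0" "weight_ratio a b t < \<infinity>"
  shows "weight_ratio a b t = ennreal (a / b powr t)" "b = 0 \<Longrightarrow> a = 0"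
proof -
  have *: "weight_ratio a b t = ennreal (a / b powr t)" if "b \<noteq> 0"
    using that assms(1) by (auto simp: weight_ratio_def divide_ennreal)
  have **: "a = 0" if "b = 0"
  proof (rule ccontr)
    assume "a \<noteq> 0"
    then show False
      using assms that by (simp add: weight_ratio_def divide_ennreal_def ennreal_mult_top)
  qed
  then show "b = 0 \<Longrightarrow> a = 0" .
  show "weight_ratio a b t = ennreal (a / b powr t)"
  proof (cases "b = 0")
    case True
    with ** show ?thesis by (simp add: weight_ratio_def)
  qed (rule *)
qed

text \<open>Induction by removing a prime \<open>p\<close>. An odd \<open>p\<close> multiplies the
  totient by at least \<open>p - 1\<close>, and \<open>p \<le> (p - 1) ^ 2\<close>. Doubling an odd
  number leaves the totient unchanged; this happens only once and costs the factor \<open>2\<close>,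
  hence the sharper claim for odd \<open>N\<close>.\<close>

lemma le_totient_square:
  "N > 0 \<Longrightarrow> N \<le> 2 * totient N ^ 2 \<and> (odd N \<longrightarrow> N \<le> totient N ^ 2)"
proof (induction N rule: less_induct)
  case (less N)
  show ?case
  proof (cases "N = 1")
    case False
    then obtain p where p: "prime p" "p dvd N"
      using prime_factor_nat by blast
    then obtain m where m: "N = p * m" by blast
    have m0: "m > 0" "m < N" using less.prems p prime_gt_1_nat[of p] by (auto simp: m)
    note IH = less.IH[OF m0(2,1)]
    show ?thesis
    proof (cases "p = 2")
      case True
      then show ?thesis
        using IH by (auto simp: m totient_double power_mult_distrib)
    next
      case False
      then have p3: "p \<ge> 3" using prime_ge_2_nat[OF p(1)] by linarith
      have tot: "(p - 1) * totient m \<le> totient N"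
      proof (cases "p dvd m")
        case True
        then show ?thesis
          using p totient_mult[of p m] m0
          by (simp add: m gcd_nat.absorb1 totient_prime mult_ac)
      next
        case False
        then have "coprime p m" using p prime_imp_coprime by blast
        then show ?thesis using p by (simp add: m totient_mult_coprime totient_prime)
      qed
      have "p \<le> (p - 1) ^ 2"
      proof -
        obtain r where r: "p = r + 3" using p3 by (metis add.commute le_Suc_ex)
        show ?thesis by (simp add: r power2_eq_square)
      qed
      then have step: "N \<le> c * totient N ^ 2" if "m \<le> c * totient m ^ 2" for c
      proof -
        have "N \<le> (p - 1) ^ 2 * (c * totient m ^ 2)"
          unfolding m by (rule mult_le_mono) (use \<open>p \<le> (p - 1) ^ 2\<close> that in auto)
        also have "\<dots> = c * ((p - 1) * totient m) ^ 2" by (simp add: power_mult_distrib)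
        also have "\<dots> \<le> c * totient N ^ 2" using tot by (intro mult_le_mono power_mono) auto
        finally show ?thesis .
      qed
      have "odd N \<Longrightarrow> odd m" by (simp add: m)
      then show ?thesis using step[of 2] step[of 1] IH by auto
    qed
  qed simp
qed

section \<open>Products of one-dimensional factors\<close>

lemma sum_prod_nonempty_subsets_le:
  fixes f :: "nat \<Rightarrow> real"
  assumes "\<And>j. j \<ge> 1 \<Longrightarrow> f j \<ge> 0"
  shows "(\<Sum>u\<in>nonempty_subsets s. \<Prod>j\<in>u. f j) \<le> (\<Prod>j=1..s. 1 + f j)"
proof -
  have "(\<Sum>u\<in>nonempty_subsets s. \<Prod>j\<in>u. f j) \<le> (\<Sum>u\<in>Pow {1..s}. \<Prod>j\<in>u. f j)"
    using assms by (intro sum_mono2 prod_nonneg) (auto simp: nonempty_subsets_def)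
  also have "\<dots> = (\<Prod>j=1..s. f j + 1)"
    by (subst prod_add) auto
  finally show ?thesis by (simp add: add.commute)
qed

lemma sum_le_suminf_Suc:
  fixes f :: "nat \<Rightarrow> real"
  assumes "summable (\<lambda>j. f (Suc j))" "\<And>j. j \<ge> 1 \<Longrightarrow> f j \<ge> 0" "finite S" "S \<subseteq> {n<..}"
  shows "sum f S \<le> (\<Sum>j. f (Suc (j + n)))"
proof -
  have gt: "j > n" if "j \<in> S" for j using assms(4) that by auto
  have "inj_on (\<lambda>j. j - n - 1) S" by (auto intro!: inj_onI dest!: gt)
  then have "sum f S = (\<Sum>j\<in>(\<lambda>j. j - n - 1) ` S. f (Suc (j + n)))"
    by (subst sum.reindex) (auto dest!: gt intro!: sum.cong)
  also have "\<dots> \<le> (\<Sum>j. f (Suc (j + n)))"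
    using assms summable_ignore_initial_segment[OF assms(1), of n] by (intro sum_le_suminf) auto
  finally show ?thesis .
qed

lemma prod_one_plus_le_exp:
  fixes f :: "nat \<Rightarrow> real"
  assumes "summable (\<lambda>j. f (Suc j))" "\<And>j. j \<ge> 1 \<Longrightarrow> f j \<ge> 0"
  shows "(\<Prod>j=1..s. 1 + f j) \<le> exp (\<Sum>j. f (Suc j))"
proof -
  have "(\<Prod>j=1..s. 1 + f j) \<le> (\<Prod>j=1..s. exp (f j))"
    using assms by (intro prod_mono) (auto simp: exp_ge_add_one_self)
  also have "\<dots> = exp (\<Sum>j=1..s. f j)" by (simp add: exp_sum)
  also have "\<dots> \<le> exp (\<Sum>j. f (Suc j))"
    using sum_le_suminf_Suc[OF assms, of "{1..s}" 0] by (simp add: subset_eq)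
  finally show ?thesis .
qed

text \<open>All but finitely many factors are bounded by \<open>exp (a j * y)\<close>; the remaining ones by a constant times
  \<open>exp (\<eta> * y)\<close> with \<open>\<eta>\<close> small.\<close>

lemma prod_one_plus_mult_le:
  fixes a :: "nat \<Rightarrow> real"
  assumes a: "summable (\<lambda>j. a (Suc j))" "\<And>j. j \<ge> 1 \<Longrightarrow> a j \<ge> 0" and \<epsilon>: "\<epsilon> > 0"
  shows "\<exists>C>0. \<forall>s. \<forall>y\<ge>0. (\<Prod>j=1..s. 1 + a j * y) \<le> C * exp (\<epsilon> * y)"
proof -
  obtain J where J: "norm (\<Sum>j. a (Suc (j + J))) < \<epsilon> / 2"
    using suminf_exist_split[OF _ a(1), of "\<epsilon> / 2"] \<epsilon> by auto
  \<comment> \<open>The first \<open>J\<close> exponents \<open>\<eta>\<close> add up to at most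
    half of \<open>\<epsilon>\<close>, and the tail accounts for the other half; \<open>+ 1\<close>
    covers \<open>J = 0\<close>.\<close>
  define \<eta> where "\<eta> = \<epsilon> / (2 * (real J + 1))"
  have \<eta>: "\<eta> > 0" "real J * \<eta> \<le> \<epsilon> / 2" using \<epsilon> by (auto simp: \<eta>_def field_simps)
  define c e where "c = (\<lambda>j. if j \<le> J then 1 + a j / \<eta> else 1)" and "e = (\<lambda>j. if j \<le> J then \<eta> else a j)"
  define C where "C = (\<Prod>j=1..J. 1 + a j / \<eta>)"
  have C: "C > 0" unfolding C_def
    using a \<eta> by (intro prod_pos) (simp add: add_pos_nonneg)
  have "(\<Prod>j=1..s. 1 + a j * y) \<le> C * exp (\<epsilon> * y)" if y: "y \<ge> 0" for s y
  proof -
    have *: "1 + a j * y \<le> c j * exp (e j * y)" if "j \<ge> 1" for j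
    proof (cases "j \<le> J")
      case True
      have "1 + a j * y \<le> (1 + a j / \<eta>) * (1 + \<eta> * y)"
        using a(2)[OF that] \<eta> y by (simp add: field_simps)
      also have "\<dots> \<le> (1 + a j / \<eta>) * exp (\<eta> * y)"
        using a(2)[OF that] \<eta> by (intro mult_left_mono exp_ge_add_one_self) auto
      finally show ?thesis using True by (simp add: c_def e_def)
    qed (simp add: c_def e_def exp_ge_add_one_self)
    have "(\<Prod>j=1..s. 1 + a j * y) \<le> (\<Prod>j=1..s. c j * exp (e j * y))"
      using * a y by (intro prod_mono) auto
    also have "\<dots> = (\<Prod>j=1..s. c j) * exp (y * (\<Sum>j=1..s. e j))"
      by (simp add: prod.distrib exp_sum sum_distrib_left mult.commute)
    also have "\<dots> \<le> C * exp (\<epsilon> * y)"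
    proof (intro mult_mono)
      have "(\<Prod>j=1..s. c j) = (\<Prod>j\<in>{1..s} \<inter> {..J}. 1 + a j / \<eta>)"
        unfolding prod.inter_restrict[OF finite_atLeastAtMost] by (simp add: c_def)
      also have "\<dots> \<le> C"
        unfolding C_def using a \<eta> by (intro prod_mono2) auto
      finally show "(\<Prod>j=1..s. c j) \<le> C" .
      have "(\<Sum>j=1..s. e j) = (\<Sum>j\<in>{1..s} \<inter> {..J}. e j) + (\<Sum>j\<in>{1..s} - {..J}. e j)"
        by (rule sum.Int_Diff) simp
      also have "(\<Sum>j\<in>{1..s} \<inter> {..J}. e j) \<le> real J * \<eta>"
      proof -
        have "(\<Sum>j\<in>{1..s} \<inter> {..J}. e j) = real (card ({1..s} \<inter> {..J})) * \<eta>" by (simp add: e_def)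
        also have "\<dots> \<le> real (card {1..J}) * \<eta>"
          using \<eta> by (intro mult_right_mono of_nat_mono card_mono) auto
        finally show ?thesis by simp
      qed
      also have "(\<Sum>j\<in>{1..s} - {..J}. e j) = (\<Sum>j\<in>{1..s} - {..J}. a j)"
        by (intro sum.cong) (auto simp: e_def)
      also have "\<dots> \<le> (\<Sum>j. a (Suc (j + J)))" by (rule sum_le_suminf_Suc[OF a]) auto
      also have "real J * \<eta> + (\<Sum>j. a (Suc (j + J))) \<le> \<epsilon>" using \<eta> J by simp
      finally show "exp (y * (\<Sum>j=1..s. e j)) \<le> exp (\<epsilon> * y)"
        using mult_left_mono[OF _ y, of "\<Sum>j=1..s. e j" \<epsilon>] by (simp add: mult.commute[of \<epsilon>])
    qed (use C in auto)
    finally show ?thesis .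
  qed
  with C show ?thesis by blast
qed

section \<open>Transfer between weights and smoothness parameters\<close>

locale korobov_weights =
  fixes \<alpha> \<alpha>' :: real and \<gamma> \<gamma>' :: "nat set \<Rightarrow> real"
  assumes \<alpha>: "\<alpha> > 1/2" and \<alpha>': "\<alpha>' > 1/2"
    and \<gamma>: "\<And>u. index_set u \<Longrightarrow> \<gamma> u \<ge> 0"
    and \<gamma>': "\<And>u. index_set u \<Longrightarrow> \<gamma>' u \<ge> 0"
    and mono: "\<And>u v. index_set u \<Longrightarrow> index_set v \<Longrightarrow> v \<subset> u \<Longrightarrow> \<gamma> v \<ge> \<gamma> u"
begin

definition "K = 2 powr (2 * \<alpha>' + 1) / (2 powr (2 * \<alpha>' - 1) - 1)"

text \<open>Expanding by \<open>2 powr (2 * \<alpha>' - 1)\<close> turns the constant of the theorem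
  into four times a geometric series, the form in which counting dual vectors produces it.\<close>

lemma K_eq: "K = 4 / (1 - 2 powr (1 - 2 * \<alpha>'))" and K_pos: "K > 0"
proof -
  define y where "y = (2::real) powr (2 * \<alpha>' - 1)"
  have y: "y > 1" using \<alpha>' powr_less_mono[of 0 "2 * \<alpha>' - 1" "2 :: real"] by (simp add: y_def)
  have "2 powr (2 * \<alpha>' + 1) = (2::real) powr ((2 * \<alpha>' - 1) + 2)"
    by (simp add: add.commute)
  also have "\<dots> = y * 4" by (simp only: powr_add y_def) simp
  finally have K: "K = y * 4 / (y - 1)"
    by (simp only: K_def y_def)
  have "2 powr (1 - 2 * \<alpha>') = 1 / y"
    using powr_minus_divide[of "2::real" "2 * \<alpha>' - 1"] by (simp add: y_def)
  with K show "K = 4 / (1 - 2 powr (1 - 2 * \<alpha>'))"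
    using y by (simp only:) (simp add: field_simps)
  from K show "K > 0" using y by simp
qed

definition "T lam s = (\<Sum>u\<in>nonempty_subsets s. \<gamma> u powr lam * (2 * real_zeta (2 * \<alpha> * lam)) ^ card u)"

text \<open>Real division makes \<open>c / 0\<close> equal to \<open>0\<close> here, so
  \<open>R\<close> is meaningful only if \<open>\<gamma>' u\<close> vanishes wherever
  \<open>\<gamma> u\<close> does. This is the hypothesis \<open>zero\<close> below.\<close>

definition "R N s = (\<Sum>u\<in>nonempty_subsets s. \<gamma>' u / \<gamma> u powr (\<alpha>' / \<alpha>) * (K ^ card u * log 2 (real N) ^ (card u - 1)))"

lemma weighted_dual_term_le:
  assumes "u \<in> nonempty_subsets s" "k \<in> dual_set N z u"
  shows "\<gamma> u * (\<Prod>j\<in>u. \<bar>real_of_int (k j)\<bar>) powr (- (2 * \<alpha>)) \<le> korobov_P \<alpha> \<gamma> N s z"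
proof -
  have iu: "index_set u" "finite u"
    using nonempty_subsets_index_set[OF assms(1)] by (auto simp: index_set_def)
  have "(\<Prod>j\<in>u. \<bar>real_of_int (k j)\<bar>) powr (- (2 * \<alpha>)) = (\<Sum>k\<in>{k}. \<Prod>j\<in>u. \<bar>real_of_int (k j)\<bar> powr (- (2 * \<alpha>)))"
    by (simp add: prod_powr_distrib)
  also have "\<dots> \<le> dual_sum (2 * \<alpha>) N z u"
    unfolding dual_sum_def using assms iu \<alpha>
    by (intro finite_sum_le_infsum summable_on_dual_set) (auto intro: prod_nonneg)
  finally have "\<gamma> u * (\<Prod>j\<in>u. \<bar>real_of_int (k j)\<bar>) powr (- (2 * \<alpha>)) \<le> \<gamma> u * dual_sum (2 * \<alpha>) N z u"
    using \<gamma>[OF iu(1)] by (rule mult_left_mono)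
  also have "\<dots> \<le> korobov_P \<alpha> \<gamma> N s z"
    unfolding korobov_P_eq_dual_sum
    by (rule member_le_sum[of u _ "\<lambda>u. \<gamma> u * dual_sum (2 * \<alpha>) N z u"])
       (use assms \<gamma> nonempty_subsets_index_set dual_sum_nonneg in auto)
  finally show ?thesis .
qed

theorem korobov_P_stability:
  assumes cbc: "cbc_vector \<alpha> \<gamma> N s z" and N: "N \<ge> 2"
    and lam: "1 / (2 * \<alpha>) < lam" "lam \<le> 1"
    and zero: "\<And>u. u \<in> nonempty_subsets s \<Longrightarrow> \<gamma> u = 0 \<Longrightarrow> \<gamma>' u = 0"
  shows "korobov_P \<alpha>' \<gamma>' N s z \<le> (T lam s / real (totient N)) powr (\<alpha>' / (\<alpha> * lam)) * R N s"
proof -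
  define B where "B = (T lam s / real (totient N)) powr (1 / lam)"
  have lam0: "lam > 0" using lam \<alpha> by (smt (verit) divide_pos_pos)
  have p: "2 * \<alpha> * lam > 1" using lam \<alpha> by (simp add: field_simps)
  note zeta = real_zeta_pos[OF p]
  have idx: "index_set u" "finite u" "u \<noteq> {}" "u \<subseteq> {1..s}" if "u \<in> nonempty_subsets s" for u
    using nonempty_subsets_index_set[OF that] that by (auto simp: index_set_def nonempty_subsets_def)
  have PB: "korobov_P \<alpha> \<gamma> N s z \<le> B"
  proof -
    have "korobov_P \<alpha> \<gamma> N s z \<ge> 0"
      unfolding korobov_P_eq_dual_sum
      by (intro sum_nonneg mult_nonneg_nonneg dual_sum_nonneg \<gamma> idx)
    then have "korobov_P \<alpha> \<gamma> N s z = (korobov_P \<alpha> \<gamma> N s z powr lam) powr (1 / lam)"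
      using lam0 by (simp add: powr_powr)
    also have "\<dots> \<le> B"
      unfolding B_def T_def using N lam0
      by (intro powr_mono2 cbc_error_bound[OF cbc _ \<gamma> lam \<alpha>]) auto
    finally show ?thesis .
  qed
  have summand_le: "\<gamma>' u * dual_sum (2 * \<alpha>') N z u \<le>
      B powr (\<alpha>' / \<alpha>) * (\<gamma>' u / \<gamma> u powr (\<alpha>' / \<alpha>) * (K ^ card u * log 2 (real N) ^ (card u - 1)))"
    if u: "u \<in> nonempty_subsets s" for u
  proof (cases "\<gamma> u = 0")
    \<comment> \<open>A vanishing weight yields no lower bound for the dual vectors, but then the
      summand vanishes as well.\<close>
    case True
    then show ?thesis using zero[OF u] by simp
  next
    case False
    then have gu: "\<gamma> u > 0" using \<gamma>[OF idx(1)[OF u]] by simp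
    \<comment> \<open>One positive weight already makes \<open>B\<close> positive, so that it can be
      divided by.\<close>
    have "T lam s > 0"
      unfolding T_def
    proof (rule sum_pos2[OF _ u])
      show "0 < \<gamma> u powr lam * (2 * real_zeta (2 * \<alpha> * lam)) ^ card u" using gu zeta by simp
    qed (use zeta in auto)
    then have B: "B > 0" using N by (simp add: B_def)
    \<comment> \<open>\<open>\<rho>\<close> is the value of the product at which
      \<open>\<gamma> u * \<rho> powr (- (2 * \<alpha>))\<close> equals \<open>B\<close>; any
      smaller product would make a single summand exceed the error bound.\<close>
    define \<rho> where "\<rho> = (\<gamma> u / B) powr (1 / (2 * \<alpha>))"
    have "dual_sum (2 * \<alpha>') N z u \<le> \<rho> powr (- (2 * \<alpha>')) *
        ((4 / (1 - 2 powr (1 - 2 * \<alpha>'))) ^ card u * log 2 (real N) ^ (card u - 1))"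
    proof (rule dual_sum_le)
      fix v k assume v: "v \<noteq> {}" "v \<subseteq> u" "k \<in> dual_set N z v"
      let ?\<Pi> = "\<Prod>j\<in>v. \<bar>real_of_int (k j)\<bar>"
      have vs: "v \<in> nonempty_subsets s" using v idx[OF u] by (auto simp: nonempty_subsets_def)
      have \<Pi>: "?\<Pi> > 0" using v(3) by (intro prod_pos) (auto simp: dual_set_def PiE_iff)
      have "\<gamma> u \<le> \<gamma> v"
        using mono[OF idx(1)[OF u] idx(1)[OF vs]] v by (cases "v = u") auto
      then have "\<gamma> u * ?\<Pi> powr (- (2 * \<alpha>)) \<le> \<gamma> v * ?\<Pi> powr (- (2 * \<alpha>))"
        by (intro mult_right_mono) auto
      also have "\<dots> \<le> B" using weighted_dual_term_le[OF vs v(3)] PB by linarith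
      finally have "\<gamma> u / B \<le> ?\<Pi> powr (2 * \<alpha>)"
        using B \<Pi> by (simp add: powr_minus field_simps)
      then have "\<rho> \<le> (?\<Pi> powr (2 * \<alpha>)) powr (1 / (2 * \<alpha>))"
        unfolding \<rho>_def using gu B \<alpha> by (intro powr_mono2) auto
      also have "\<dots> = ?\<Pi>" using \<alpha> \<Pi> by (simp add: powr_powr)
      finally show "\<rho> \<le> ?\<Pi>" .
    next
      show "z j \<in> {1..N - 1}" if "j \<in> u" for j
        using cbc idx[OF u] that by (auto simp: cbc_vector_def)
    qed (use idx[OF u] N \<alpha>' gu B in \<open>auto simp: \<rho>_def\<close>)
    also have "\<rho> powr (- (2 * \<alpha>')) = B powr (\<alpha>' / \<alpha>) / \<gamma> u powr (\<alpha>' / \<alpha>)"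
      using gu B \<alpha> by (simp add: \<rho>_def powr_powr powr_minus_divide powr_divide)
    finally have "\<gamma>' u * dual_sum (2 * \<alpha>') N z u \<le> \<gamma>' u * (B powr (\<alpha>' / \<alpha>) / \<gamma> u powr (\<alpha>' / \<alpha>) *
        (K ^ card u * log 2 (real N) ^ (card u - 1)))"
      unfolding K_eq using \<gamma>'[OF idx(1)[OF u]] by (rule mult_left_mono)
    then show ?thesis by (simp add: mult_ac)
  qed
  have "korobov_P \<alpha>' \<gamma>' N s z \<le> B powr (\<alpha>' / \<alpha>) * R N s"
    unfolding korobov_P_eq_dual_sum R_def sum_distrib_left by (intro sum_mono summand_le)
  also have "B powr (\<alpha>' / \<alpha>) = (T lam s / real (totient N)) powr (\<alpha>' / (\<alpha> * lam))"
    by (simp add: B_def powr_powr mult.commute)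
  finally show ?thesis .
qed

lemma R_nonneg: "N \<ge> 2 \<Longrightarrow> R N s \<ge> 0"
  unfolding R_def using K_pos \<gamma>' nonempty_subsets_index_set
  by (intro sum_nonneg mult_nonneg_nonneg) auto

text \<open>Common end of both parts. \<open>M\<close> and \<open>M'\<close> may depend on
  \<open>s\<close>: general weights insert powers of \<open>s\<close>, product weights insert
  constants.\<close>

lemma korobov_P_le_of_bounds:
  assumes cbc: "cbc_vector \<alpha> \<gamma> N s z" and N: "N \<ge> 2"
    and lam: "1 / (2 * \<alpha>) < lam" "lam \<le> 1"
    and zero: "\<And>u. u \<in> nonempty_subsets s \<Longrightarrow> \<gamma> u = 0 \<Longrightarrow> \<gamma>' u = 0"
    and T: "T lam s \<le> M" and R: "R N s \<le> M' * real (totient N) powr \<delta>"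
  shows "korobov_P \<alpha>' \<gamma>' N s z \<le> M powr (\<alpha>' / (\<alpha> * lam)) * M' * real (totient N) powr (- \<alpha>' / (\<alpha> * lam) + \<delta>)"
proof -
  define e where "e = \<alpha>' / (\<alpha> * lam)"
  have lam0: "lam > 0" using lam \<alpha> by (smt (verit) divide_pos_pos)
  have e: "e > 0" using lam0 \<alpha> \<alpha>' by (simp add: e_def)
  have phi: "real (totient N) > 0" using N by simp
  have p: "2 * \<alpha> * lam > 1" using lam \<alpha> by (simp add: field_simps)
  have T0: "T lam s \<ge> 0"
    unfolding T_def using real_zeta_pos[OF p] by (intro sum_nonneg) auto
  have "korobov_P \<alpha>' \<gamma>' N s z \<le> (T lam s / real (totient N)) powr e * R N s"
    unfolding e_def by (rule korobov_P_stability[OF cbc N lam zero])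
  also have "\<dots> \<le> (M / real (totient N)) powr e * (M' * real (totient N) powr \<delta>)"
    using T T0 R R_nonneg[OF N] e phi
    by (intro mult_mono powr_mono2 divide_right_mono) auto
  also have "\<dots> = M powr e * M' * real (totient N) powr (- e + \<delta>)"
    using phi T T0 by (simp add: powr_divide powr_add powr_minus_divide powr_diff)
  finally show ?thesis by (simp add: e_def)
qed

text \<open>A finite supremum forces every single ratio to be finite. This gives the condition on
  zeros of the weights, and with it the extended sum becomes the real number
  \<open>R N s\<close>.\<close>

lemma ratio_sum_bound:
  assumes "(SUP (s, N) \<in> {1..} \<times> {1..}. ennreal (1 / (real s powr q' * real (totient N) powr \<delta>)) *
            (\<Sum>u\<in>nonempty_subsets s. weight_ratio (\<gamma>' u) (\<gamma> u) (\<alpha>' / \<alpha>) *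
               ennreal (K ^ card u * log 2 (real N) ^ (card u - 1)))) < \<infinity>"
  obtains M where "M \<ge> 0"
    "\<And>s N. s \<ge> 1 \<Longrightarrow> N \<ge> 2 \<Longrightarrow> R N s \<le> M * real s powr q' * real (totient N) powr \<delta>"
    "\<And>s u. s \<ge> 1 \<Longrightarrow> u \<in> nonempty_subsets s \<Longrightarrow> \<gamma> u = 0 \<Longrightarrow> \<gamma>' u = 0"
proof -
  let ?W = "\<lambda>N u. weight_ratio (\<gamma>' u) (\<gamma> u) (\<alpha>' / \<alpha>) * ennreal (K ^ card u * log 2 (real N) ^ (card u - 1))"
  let ?f = "\<lambda>s N. ennreal (1 / (real s powr q' * real (totient N) powr \<delta>)) * (\<Sum>u\<in>nonempty_subsets s. ?W N u)"
  define S where "S = (SUP (s, N) \<in> {1..} \<times> {1..}. ?f s N)"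
  obtain M where M: "M \<ge> 0" "S = ennreal M"
    using assms unfolding S_def[symmetric] by (cases S) auto
  have fS: "?f s N \<le> ennreal M" if "s \<ge> 1" "N \<ge> 1" for s N
    unfolding M(2)[symmetric] S_def
    by (rule SUP_upper2[of "(s, N)"]) (use that in auto)
  have fin: "weight_ratio (\<gamma>' u) (\<gamma> u) (\<alpha>' / \<alpha>) < \<infinity>" if s: "s \<ge> 1" and u: "u \<in> nonempty_subsets s" for s u
  proof (rule ccontr)
    assume "\<not> weight_ratio (\<gamma>' u) (\<gamma> u) (\<alpha>' / \<alpha>) < \<infinity>"
    \<comment> \<open>\<open>N = 2\<close> is chosen because \<open>log 2 2 = 1\<close>: the second
      factor is then positive and cannot cancel an infinite ratio, as the factor \<open>0\<close>
      from \<open>N = 1\<close> could.\<close>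
    then have "?W 2 u = \<infinity>" using K_pos by (simp add: less_top[symmetric] ennreal_top_mult)
    moreover have "?W 2 u \<le> (\<Sum>u\<in>nonempty_subsets s. ?W 2 u)"
      by (rule member_le_sum) (use u in auto)
    ultimately have "(\<Sum>u\<in>nonempty_subsets s. ?W 2 u) = \<infinity>" by (simp add: top_unique)
    then have "?f s 2 = \<infinity>" using s by (simp only: infinity_ennreal_def) (simp add: ennreal_mult_top)
    with fS[OF s, of 2] show False by (simp add: top_unique)
  qed
  have R: "R N s \<le> M * real s powr q' * real (totient N) powr \<delta>" if s: "s \<ge> 1" and N: "N \<ge> 2" for s N
  proof -
    define c where "c = real s powr q' * real (totient N) powr \<delta>"
    have c: "c > 0" using s N by (simp add: c_def)
    have L: "log 2 (real N) \<ge> 0" using N by simp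
    have "(\<Sum>u\<in>nonempty_subsets s. ?W N u) =
      (\<Sum>u\<in>nonempty_subsets s. ennreal (\<gamma>' u / \<gamma> u powr (\<alpha>' / \<alpha>) * (K ^ card u * log 2 (real N) ^ (card u - 1))))"
    proof (rule sum.cong[OF refl])
      fix u assume u: "u \<in> nonempty_subsets s"
      have g: "\<gamma>' u \<ge> 0" by (rule \<gamma>'[OF nonempty_subsets_index_set[OF u]])
      show "?W N u = ennreal (\<gamma>' u / \<gamma> u powr (\<alpha>' / \<alpha>) * (K ^ card u * log 2 (real N) ^ (card u - 1)))"
        unfolding weight_ratio_finite(1)[OF g fin[OF s u]]
        using g K_pos L by (intro ennreal_mult[symmetric]) auto
    qed
    also have "\<dots> = ennreal (R N s)"
      unfolding R_def using \<gamma>' nonempty_subsets_index_set K_pos L by (intro sum_ennreal) auto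
    finally have "?f s N = ennreal (1 / c * R N s)"
      using c R_nonneg[OF N] by (simp add: ennreal_mult'[symmetric] flip: c_def)
    with fS[of s N] s N have "1 / c * R N s \<le> M"
      using M(1) by (simp add: ennreal_le_iff)
    then show ?thesis using c by (simp add: c_def field_simps)
  qed
  have "\<gamma>' u = 0" if "s \<ge> 1" "u \<in> nonempty_subsets s" "\<gamma> u = 0" for s u
    by (rule weight_ratio_finite(2)[OF \<gamma>'[OF nonempty_subsets_index_set[OF that(2)]] fin[OF that(1,2)] that(3)])
  with M(1) R show ?thesis using that by blast
qed

theorem general_weights:
  assumes lam: "1 / (2 * \<alpha>) < lam" "lam < 1"
    and T: "bdd_above ((\<lambda>s. 1 / real s powr q * T lam s) ` {1..})"
    and R: "(SUP (s, N) \<in> {1..} \<times> {1..}. ennreal (1 / (real s powr q' * real (totient N) powr \<delta>)) *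
            (\<Sum>u\<in>nonempty_subsets s. weight_ratio (\<gamma>' u) (\<gamma> u) (\<alpha>' / \<alpha>) *
               ennreal (K ^ card u * log 2 (real N) ^ (card u - 1)))) < \<infinity>"
  shows "\<exists>C>0. \<forall>s\<ge>1. \<forall>N\<ge>2. \<forall>z. cbc_vector \<alpha> \<gamma> N s z \<longrightarrow>
              korobov_P \<alpha>' \<gamma>' N s z
                \<le> C * real s powr (q * \<alpha>' / (\<alpha> * lam) + q')
                    * real (totient N) powr (- \<alpha>' / (\<alpha> * lam) + \<delta>)"
proof -
  let ?e = "\<alpha>' / (\<alpha> * lam)"
  obtain M0 where M0: "\<And>s. s \<ge> 1 \<Longrightarrow> 1 / real s powr q * T lam s \<le> M0"
    using T by (auto simp: bdd_above_def)
  define M where "M = max M0 0"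
  have M: "M \<ge> 0" by (simp add: M_def)
  have TM: "T lam s \<le> M * real s powr q" if "s \<ge> 1" for s
  proof -
    have "1 / real s powr q * T lam s \<le> M" using M0[OF that] by (simp add: M_def)
    then show ?thesis using that by (simp add: field_simps)
  qed
  obtain M' where M': "M' \<ge> 0"
    and RM: "\<And>s N. s \<ge> 1 \<Longrightarrow> N \<ge> 2 \<Longrightarrow> R N s \<le> M' * real s powr q' * real (totient N) powr \<delta>"
    and zero: "\<And>s u. s \<ge> 1 \<Longrightarrow> u \<in> nonempty_subsets s \<Longrightarrow> \<gamma> u = 0 \<Longrightarrow> \<gamma>' u = 0"
    using ratio_sum_bound[OF R] by metis
  \<comment> \<open>The added \<open>1\<close> guarantees a positive constant, since
    \<open>M\<close> or \<open>M'\<close> may be \<open>0\<close>.\<close>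
  have bound: "korobov_P \<alpha>' \<gamma>' N s z \<le> (M powr ?e * M' + 1) * real s powr (q * \<alpha>' / (\<alpha> * lam) + q')
                    * real (totient N) powr (- \<alpha>' / (\<alpha> * lam) + \<delta>)"
    if s: "s \<ge> 1" and N: "N \<ge> 2" and cbc: "cbc_vector \<alpha> \<gamma> N s z" for s N z
  proof -
    have "korobov_P \<alpha>' \<gamma>' N s z \<le> (M * real s powr q) powr ?e * (M' * real s powr q') *
        real (totient N) powr (- \<alpha>' / (\<alpha> * lam) + \<delta>)"
      using lam by (intro korobov_P_le_of_bounds[OF cbc N] zero[OF s] TM[OF s] RM[OF s N]) auto
    also have "(M * real s powr q) powr ?e * (M' * real s powr q') =
        M powr ?e * M' * real s powr (q * \<alpha>' / (\<alpha> * lam) + q')"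
      using M by (simp add: powr_mult powr_powr powr_add mult_ac)
    also have "\<dots> * real (totient N) powr (- \<alpha>' / (\<alpha> * lam) + \<delta>) \<le>
       (M powr ?e * M' + 1) * real s powr (q * \<alpha>' / (\<alpha> * lam) + q') *
        real (totient N) powr (- \<alpha>' / (\<alpha> * lam) + \<delta>)"
      by (intro mult_right_mono) auto
    finally show ?thesis .
  qed
  have "M powr ?e * M' + 1 > 0" using M' by (simp add: add_nonneg_pos)
  with bound show ?thesis by blast
qed

theorem product_weights:
  fixes g g' :: "nat \<Rightarrow> real"
  assumes g: "\<And>j. j \<ge> 1 \<Longrightarrow> g j \<ge> 0" "\<And>j. j \<ge> 1 \<Longrightarrow> g' j \<ge> 0"
    and prod: "\<And>u. index_set u \<Longrightarrow> \<gamma> u = (\<Prod>j\<in>u. g j)" "\<And>u. index_set u \<Longrightarrow> \<gamma>' u = (\<Prod>j\<in>u. g' j)"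
    and lam: "1 / (2 * \<alpha>) < lam" "lam \<le> 1"
    and summable_g: "summable (\<lambda>j. g (Suc j) powr lam)"
    and summable_ratio: "(\<Sum>j. weight_ratio (g' (Suc j)) (g (Suc j)) (\<alpha>' / \<alpha>)) < \<infinity>"
    and \<delta>: "\<delta> > 0"
  shows "\<exists>C>0. \<forall>s\<ge>1. \<forall>N\<ge>2. \<forall>z. cbc_vector \<alpha> \<gamma> N s z \<longrightarrow>
              korobov_P \<alpha>' \<gamma>' N s z \<le> C * real (totient N) powr (- \<alpha>' / (\<alpha> * lam) + \<delta>)"
proof -
  have p: "2 * \<alpha> * lam > 1" using lam \<alpha> by (simp add: field_simps)
  define c where "c = 2 * real_zeta (2 * \<alpha> * lam)"
  have c: "c > 0" using real_zeta_pos[OF p] by (simp add: c_def)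
  define a where "a = (\<lambda>j. g' j / g j powr (\<alpha>' / \<alpha>))"
  have a0: "a j \<ge> 0" if "j \<ge> 1" for j using g(2)[OF that] by (simp add: a_def)
  have ratio_fin: "weight_ratio (g' (Suc j)) (g (Suc j)) (\<alpha>' / \<alpha>) < \<infinity>" for j
  proof -
    have "weight_ratio (g' (Suc j)) (g (Suc j)) (\<alpha>' / \<alpha>) \<le> (\<Sum>j. weight_ratio (g' (Suc j)) (g (Suc j)) (\<alpha>' / \<alpha>))"
      using sum_le_suminf[of "\<lambda>j. weight_ratio (g' (Suc j)) (g (Suc j)) (\<alpha>' / \<alpha>)" "{j}"] by simp
    with summable_ratio show ?thesis by simp
  qed
  note ratio = weight_ratio_finite[OF g(2) ratio_fin]
  have zero_j: "g' j = 0" if "j \<ge> 1" "g j = 0" for j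
    using ratio(2)[of "j - 1"] that by simp
  have zero: "\<gamma>' u = 0" if us: "u \<in> nonempty_subsets s" and u0: "\<gamma> u = 0" for u s
  proof -
    have u: "index_set u" by (rule nonempty_subsets_index_set[OF us])
    then obtain j where "j \<in> u" "g j = 0"
      using u0 by (auto simp: prod index_set_def)
    then show ?thesis
      using u zero_j[of j] by (auto simp: prod index_set_def)
  qed
  have summable_a: "summable (\<lambda>j. a (Suc j))"
  proof -
    have "(\<Sum>j. ennreal (a (Suc j))) \<noteq> \<infinity>"
      using summable_ratio by (simp add: ratio(1) a_def)
    then show ?thesis
      using a0 by (intro summable_suminf_not_top) auto
  qed
  define M where "M = exp (\<Sum>j. g (Suc j) powr lam * c)"
  have TM: "T lam s \<le> M" for s
  proof -
    have "T lam s = (\<Sum>u\<in>nonempty_subsets s. \<Prod>j\<in>u. g j powr lam * c)"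
      unfolding T_def c_def[symmetric] using nonempty_subsets_index_set prod(1)
      by (intro sum.cong) (auto simp: prod_powr_distrib prod.distrib)
    also have "\<dots> \<le> (\<Prod>j=1..s. 1 + g j powr lam * c)"
      using c by (intro sum_prod_nonempty_subsets_le) auto
    also have "\<dots> \<le> M"
      unfolding M_def using c summable_g by (intro prod_one_plus_le_exp summable_mult2) auto
    finally show ?thesis .
  qed
  \<comment> \<open>Chosen so that \<open>exp (\<epsilon> * 2 * log 2 \<phi>(N))\<close> is
    \<open>\<phi>(N) powr \<delta>\<close>: the \<open>2\<close> comes from the square in
    \<open>le_totient_square\<close>, and \<open>ln 2\<close> from the base of the
    logarithm.\<close>
  define \<epsilon> where "\<epsilon> = \<delta> * ln 2 / 2"
  obtain C where C: "C > 0" "\<And>s y. y \<ge> 0 \<Longrightarrow> (\<Prod>j=1..s. 1 + a j * K * y) \<le> C * exp (\<epsilon> * y)"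
    using prod_one_plus_mult_le[of "\<lambda>j. a j * K" \<epsilon>] summable_a a0 K_pos \<delta>
    by (auto simp: \<epsilon>_def summable_mult2)
  have RC: "R N s \<le> C * exp \<epsilon> * real (totient N) powr \<delta>" if N: "N \<ge> 2" for N s
  proof -
    define L where "L = log 2 (real N)"
    have L: "L \<ge> 1" using N by (simp add: L_def le_log_iff)
    have phi: "real (totient N) > 0" using N by simp
    have "R N s \<le> (\<Sum>u\<in>nonempty_subsets s. \<Prod>j\<in>u. a j * K * L)"
      unfolding R_def L_def[symmetric]
    proof (rule sum_mono)
      fix u assume "u \<in> nonempty_subsets s"
      then have u: "index_set u" by (rule nonempty_subsets_index_set)
      \<comment> \<open>One more factor \<open>L \<ge> 1\<close> makes the summand a product over
        \<open>u\<close>; the loss is absorbed by \<open>\<delta>\<close>.\<close>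
      have "\<gamma>' u / \<gamma> u powr (\<alpha>' / \<alpha>) * (K ^ card u * L ^ (card u - 1)) \<le>
        \<gamma>' u / \<gamma> u powr (\<alpha>' / \<alpha>) * (K ^ card u * L ^ card u)"
        using L K_pos \<gamma>'[OF u] by (intro mult_left_mono power_increasing) auto
      also have "\<dots> = (\<Prod>j\<in>u. a j * K * L)"
        using u by (simp add: prod a_def prod_powr_distrib prod.distrib prod_dividef power_mult_distrib mult.assoc)
      finally show "\<gamma>' u / \<gamma> u powr (\<alpha>' / \<alpha>) * (K ^ card u * L ^ (card u - 1)) \<le> (\<Prod>j\<in>u. a j * K * L)" .
    qed
    also have "\<dots> \<le> (\<Prod>j=1..s. 1 + a j * K * L)"
      using a0 K_pos L by (intro sum_prod_nonempty_subsets_le) auto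
    also have "\<dots> \<le> C * exp (\<epsilon> * L)" using L by (intro C(2)) auto
    also have "\<dots> \<le> C * (exp \<epsilon> * real (totient N) powr \<delta>)"
    proof -
      have "N \<le> 2 * totient N ^ 2" using le_totient_square[of N] N by simp
      then have "real N \<le> real (2 * totient N ^ 2)" by (simp only: of_nat_le_iff)
      then have "L \<le> log 2 (2 * real (totient N) ^ 2)"
        unfolding L_def using N by (intro log_mono) auto
      also have "\<dots> = 1 + 2 * log 2 (real (totient N))"
        using phi by (simp add: log_mult log_nat_power)
      finally have "\<epsilon> * L \<le> \<epsilon> * (1 + 2 * log 2 (real (totient N)))"
        using \<delta> by (intro mult_left_mono) (auto simp: \<epsilon>_def)
      also have "\<dots> = \<epsilon> + \<delta> * ln (real (totient N))"
        by (simp add: \<epsilon>_def log_def field_simps)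
      finally have "exp (\<epsilon> * L) \<le> exp (\<epsilon> + \<delta> * ln (real (totient N)))" by simp
      also have "\<dots> = exp \<epsilon> * real (totient N) powr \<delta>"
        using N by (simp add: exp_add powr_def)
      finally show ?thesis using C(1) by simp
    qed
    finally show ?thesis by (simp add: mult.assoc)
  qed
  have "korobov_P \<alpha>' \<gamma>' N s z \<le> M powr (\<alpha>' / (\<alpha> * lam)) * (C * exp \<epsilon>) * real (totient N) powr (- \<alpha>' / (\<alpha> * lam) + \<delta>)"
    if "N \<ge> 2" "cbc_vector \<alpha> \<gamma> N s z" for s N z
    using korobov_P_le_of_bounds[OF that(2,1) lam zero TM RC[OF that(1)]] .
  moreover have "M powr (\<alpha>' / (\<alpha> * lam)) * (C * exp \<epsilon>) > 0"
    using C by (simp add: M_def)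
  ultimately show ?thesis by blast
qed

end

theorem corollary1:
  fixes \<alpha> \<alpha>' :: real and \<gamma> \<gamma>' :: "nat set \<Rightarrow> real"
  assumes "\<alpha> > 1/2" and "\<alpha>' > 1/2"
    and "\<And>u. index_set u \<Longrightarrow> \<gamma> u \<ge> 0"
    and "\<And>u. index_set u \<Longrightarrow> \<gamma>' u \<ge> 0"
    and "\<And>u v. index_set u \<Longrightarrow> index_set v \<Longrightarrow> v \<subset> u \<Longrightarrow> \<gamma> v \<ge> \<gamma> u"
  shows
    "(\<forall>lam \<delta> q q' :: real.
        1 / (2 * \<alpha>) < lam \<and> lam < 1 \<and> 0 < \<delta> \<and> \<delta> < \<alpha>' / (\<alpha> * lam) \<and> q \<ge> 0 \<and> q' \<ge> 0 \<and>
        bdd_above ((\<lambda>s. 1 / real s powr q *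
            (\<Sum>u\<in>nonempty_subsets s. \<gamma> u powr lam * (2 * real_zeta (2 * \<alpha> * lam)) ^ card u)) ` {1..}) \<and>
        (SUP (s, N) \<in> {1..} \<times> {1..}. ennreal (1 / (real s powr q' * real (totient N) powr \<delta>)) *
            (\<Sum>u\<in>nonempty_subsets s. weight_ratio (\<gamma>' u) (\<gamma> u) (\<alpha>' / \<alpha>) *
               ennreal ((2 powr (2 * \<alpha>' + 1) / (2 powr (2 * \<alpha>' - 1) - 1)) ^ card u *
                        log 2 (real N) ^ (card u - 1)))) < \<infinity>
        \<longrightarrow> (\<exists>C>0. \<forall>s\<ge>1. \<forall>N\<ge>2. \<forall>z. cbc_vector \<alpha> \<gamma> N s z \<longrightarrow>
              korobov_P \<alpha>' \<gamma>' N s z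
                \<le> C * real s powr (q * \<alpha>' / (\<alpha> * lam) + q')
                    * real (totient N) powr (- \<alpha>' / (\<alpha> * lam) + \<delta>)))
     \<and>
     (\<forall>lam \<delta> :: real.
        1 / (2 * \<alpha>) < lam \<and> lam < 1 \<and> 0 < \<delta> \<and> \<delta> < \<alpha>' / (\<alpha> * lam) \<and>
        bdd_above ((\<lambda>s.
            (\<Sum>u\<in>nonempty_subsets s. \<gamma> u powr lam * (2 * real_zeta (2 * \<alpha> * lam)) ^ card u)) ` {1..}) \<and>
        (SUP (s, N) \<in> {1..} \<times> {1..}. ennreal (1 / real (totient N) powr \<delta>) *
            (\<Sum>u\<in>nonempty_subsets s. weight_ratio (\<gamma>' u) (\<gamma> u) (\<alpha>' / \<alpha>) *
               ennreal ((2 powr (2 * \<alpha>' + 1) / (2 powr (2 * \<alpha>' - 1) - 1)) ^ card u *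
                        log 2 (real N) ^ (card u - 1)))) < \<infinity>
        \<longrightarrow> (\<exists>C>0. \<forall>s\<ge>1. \<forall>N\<ge>2. \<forall>z. cbc_vector \<alpha> \<gamma> N s z \<longrightarrow>
              korobov_P \<alpha>' \<gamma>' N s z \<le> C * real (totient N) powr (- \<alpha>' / (\<alpha> * lam) + \<delta>) \<and>
              korobov_P \<alpha>' \<gamma>' N s z \<le> C))
     \<and>
     (\<forall>(g :: nat \<Rightarrow> real) (g' :: nat \<Rightarrow> real) lam :: real.
        (\<forall>j\<ge>1. g j \<ge> 0 \<and> g' j \<ge> 0) \<and>
        (\<forall>u. index_set u \<longrightarrow> \<gamma> u = (\<Prod>j\<in>u. g j) \<and> \<gamma>' u = (\<Prod>j\<in>u. g' j)) \<and>
        1 / (2 * \<alpha>) < lam \<and> lam \<le> 1 \<and>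
        summable (\<lambda>j. g (Suc j) powr lam) \<and>
        (\<Sum>j. weight_ratio (g' (Suc j)) (g (Suc j)) (\<alpha>' / \<alpha>)) < \<infinity>
        \<longrightarrow> (\<forall>\<delta>>0. \<exists>C>0. \<forall>s\<ge>1. \<forall>N\<ge>2. \<forall>z. cbc_vector \<alpha> \<gamma> N s z \<longrightarrow>
              korobov_P \<alpha>' \<gamma>' N s z \<le> C * real (totient N) powr (- \<alpha>' / (\<alpha> * lam) + \<delta>)))"
proof -
  interpret korobov_weights \<alpha> \<alpha>' \<gamma> \<gamma>'
    using assms by unfold_locales auto
  show ?thesis
  proof (intro conjI allI impI; (elim conjE)?)
    fix lam \<delta> q q' :: real
    assume "1 / (2 * \<alpha>) < lam" "lam < 1"
      "bdd_above ((\<lambda>s. 1 / real s powr q *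
            (\<Sum>u\<in>nonempty_subsets s. \<gamma> u powr lam * (2 * real_zeta (2 * \<alpha> * lam)) ^ card u)) ` {1..})"
      "(SUP (s, N) \<in> {1..} \<times> {1..}. ennreal (1 / (real s powr q' * real (totient N) powr \<delta>)) *
            (\<Sum>u\<in>nonempty_subsets s. weight_ratio (\<gamma>' u) (\<gamma> u) (\<alpha>' / \<alpha>) *
               ennreal ((2 powr (2 * \<alpha>' + 1) / (2 powr (2 * \<alpha>' - 1) - 1)) ^ card u *
                        log 2 (real N) ^ (card u - 1)))) < \<infinity>"
    then show "\<exists>C>0. \<forall>s\<ge>1. \<forall>N\<ge>2. \<forall>z. cbc_vector \<alpha> \<gamma> N s z \<longrightarrow>
        korobov_P \<alpha>' \<gamma>' N s z \<le> C * real s powr (q * \<alpha>' / (\<alpha> * lam) + q')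
          * real (totient N) powr (- \<alpha>' / (\<alpha> * lam) + \<delta>)"
      by (rule general_weights[unfolded T_def K_def])
  next
    fix lam \<delta> :: real
    assume lam: "1 / (2 * \<alpha>) < lam" "lam < 1" and \<delta>: "\<delta> < \<alpha>' / (\<alpha> * lam)"
      and T: "bdd_above ((\<lambda>s.
            (\<Sum>u\<in>nonempty_subsets s. \<gamma> u powr lam * (2 * real_zeta (2 * \<alpha> * lam)) ^ card u)) ` {1..})"
      and R: "(SUP (s, N) \<in> {1..} \<times> {1..}. ennreal (1 / real (totient N) powr \<delta>) *
            (\<Sum>u\<in>nonempty_subsets s. weight_ratio (\<gamma>' u) (\<gamma> u) (\<alpha>' / \<alpha>) *
               ennreal ((2 powr (2 * \<alpha>' + 1) / (2 powr (2 * \<alpha>' - 1) - 1)) ^ card u *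
                        log 2 (real N) ^ (card u - 1)))) < \<infinity>"
    \<comment> \<open>Since \<open>s \<ge> 1\<close>, the factor \<open>real s powr 0\<close> is
      \<open>1\<close> and not the default \<open>0 powr 0 = 0\<close>.\<close>
    have "(\<lambda>s. 1 / real s powr 0 * T lam s) ` {1..} = T lam ` {1..}"
      by (intro image_cong) auto
    with T have T': "bdd_above ((\<lambda>s. 1 / real s powr 0 * T lam s) ` {1..})"
      by (simp add: T_def[abs_def])
    have R': "(SUP (s, N) \<in> {1..} \<times> {1..}. ennreal (1 / (real s powr 0 * real (totient N) powr \<delta>)) *
            (\<Sum>u\<in>nonempty_subsets s. weight_ratio (\<gamma>' u) (\<gamma> u) (\<alpha>' / \<alpha>) *
               ennreal (K ^ card u * log 2 (real N) ^ (card u - 1)))) < \<infinity>"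
      unfolding K_def by (rule le_less_trans[OF eq_refl R], intro SUP_cong) auto
    obtain C where C: "C > 0" and bound: "\<And>s N z. s \<ge> 1 \<Longrightarrow> N \<ge> 2 \<Longrightarrow> cbc_vector \<alpha> \<gamma> N s z \<Longrightarrow>
        korobov_P \<alpha>' \<gamma>' N s z \<le> C * real s powr (0 * \<alpha>' / (\<alpha> * lam) + 0)
          * real (totient N) powr (- \<alpha>' / (\<alpha> * lam) + \<delta>)"
      using general_weights[OF lam T' R'] by blast
    have "korobov_P \<alpha>' \<gamma>' N s z \<le> C * real (totient N) powr (- \<alpha>' / (\<alpha> * lam) + \<delta>)"
      "korobov_P \<alpha>' \<gamma>' N s z \<le> C"
      if "s \<ge> 1" "N \<ge> 2" "cbc_vector \<alpha> \<gamma> N s z" for s N z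
    proof -
      show *: "korobov_P \<alpha>' \<gamma>' N s z \<le> C * real (totient N) powr (- \<alpha>' / (\<alpha> * lam) + \<delta>)"
        using bound[OF that] that(1) by simp
      \<comment> \<open>By \<open>\<delta> < \<alpha>' / (\<alpha> * lam)\<close> the exponent is
        negative, so the power of the totient is at most \<open>1\<close> and \<open>C\<close>
        itself is a bound.\<close>
      have "totient N \<ge> 1" using that(2) by (simp add: Suc_le_eq)
      then have "real (totient N) powr (- \<alpha>' / (\<alpha> * lam) + \<delta>) \<le> real (totient N) powr 0"
        using \<delta> by (intro powr_mono) auto
      also have "\<dots> = 1" using that(2) by simp
      finally have "C * real (totient N) powr (- \<alpha>' / (\<alpha> * lam) + \<delta>) \<le> C * 1"
        using C by (intro mult_left_mono) auto
      with * show "korobov_P \<alpha>' \<gamma>' N s z \<le> C" by simp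
    qed
    with C show "\<exists>C>0. \<forall>s\<ge>1. \<forall>N\<ge>2. \<forall>z. cbc_vector \<alpha> \<gamma> N s z \<longrightarrow>
        korobov_P \<alpha>' \<gamma>' N s z \<le> C * real (totient N) powr (- \<alpha>' / (\<alpha> * lam) + \<delta>) \<and>
        korobov_P \<alpha>' \<gamma>' N s z \<le> C"
      by blast
  next
    fix g g' :: "nat \<Rightarrow> real" and lam \<delta> :: real
    assume "\<forall>j\<ge>1. g j \<ge> 0 \<and> g' j \<ge> 0"
      "\<forall>u. index_set u \<longrightarrow> \<gamma> u = (\<Prod>j\<in>u. g j) \<and> \<gamma>' u = (\<Prod>j\<in>u. g' j)"
      "1 / (2 * \<alpha>) < lam" "lam \<le> 1" "summable (\<lambda>j. g (Suc j) powr lam)"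
      "(\<Sum>j. weight_ratio (g' (Suc j)) (g (Suc j)) (\<alpha>' / \<alpha>)) < \<infinity>" "\<delta> > 0"
    then show "\<exists>C>0. \<forall>s\<ge>1. \<forall>N\<ge>2. \<forall>z. cbc_vector \<alpha> \<gamma> N s z \<longrightarrow>
        korobov_P \<alpha>' \<gamma>' N s z \<le> C * real (totient N) powr (- \<alpha>' / (\<alpha> * lam) + \<delta>)"
      by (intro product_weights[of g g']) auto
  qed
qed

end
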